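(* For every $\varepsilon>0$ there exists a Schauder basis $(z_j)_{j=1}^\infty$ of $L_2(\mathbb{R})$ such that every $z_j$ is a non-negative function and the basis constant of $(z_j)_{j=1}^\infty$ is at most $1+\varepsilon$.
   Context: A sequence $(x_j)$ in a Banach space $X$ is a Schauder basis if every $x\in X$ has a unique representation $x=\sum_{j=1}^\infty a_jx_j$ (norm convergence). Its basis constant is the least $C$ such that $\|\sum_{j=1}^m a_jx_j\|\le C\|\sum_{j=1}^n a_jx_j\|$ for all $m\le n$ and all scalars $(a_j)$. A function in $L_2(\mathbb{R})$ is non-negative if it is $\ge 0$ almost everywhere. *)

theory Defs
  imports "HOL-Analysis.Analysis"
begin

text \<open>Real L_2(R): Borel measurable functions with integrable square (elements are
  representatives; functions equal a.e. have distance 0).\<close>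
definition L2 :: "(real \<Rightarrow> real) set" where
  "L2 = {f. f \<in> borel_measurable lborel \<and> integrable lborel (\<lambda>x. (f x)^2)}"

definition L2norm :: "(real \<Rightarrow> real) \<Rightarrow> real" where
  "L2norm f = sqrt (LINT x|lborel. (f x)^2)"

definition schauder_basis_L2 :: "(nat \<Rightarrow> real \<Rightarrow> real) \<Rightarrow> bool" where
  "schauder_basis_L2 z \<longleftrightarrow> (\<forall>j. z j \<in> L2) \<and>
     (\<forall>x\<in>L2. \<exists>!a::nat \<Rightarrow> real.
        (\<lambda>n. L2norm (\<lambda>t. x t - (\<Sum>j<n. a j * z j t))) \<longlonglongrightarrow> 0)"

text \<open>The basis constant is at most C (the least constant is attained, so this is
  equivalent to the basis constant being \<le> C).\<close>
definition basis_constant_le :: "(nat \<Rightarrow> real \<Rightarrow> real) \<Rightarrow> real \<Rightarrow> bool" where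
  "basis_constant_le z C \<longleftrightarrow> (\<forall>(a::nat \<Rightarrow> real) m n. m \<le> n \<longrightarrow>
      L2norm (\<lambda>t. \<Sum>j<m. a j * z j t) \<le> C * L2norm (\<lambda>t. \<Sum>j<n. a j * z j t))"

end

theory Submission
  imports Defs
begin

text \<open>The basis is built in blocks. Given a finite-dimensional span \<open>V\<close> of compactly supported functions and
  a unit vector \<open>r\<close> orthogonal to \<open>V\<close>, one adds a finite block of non-negative functions whose span
  almost contains \<open>r\<close>, while the basis constant grows by a factor close to 1. The block comes from
  \<open>Z\<^sub>j = e\<^sub>j + (1 - \<delta>) / R * (\<Sum>r<R. e\<^bsub>j + 3 ^ r\<^esub>)\<close> with disjoint intervals \<open>e\<^sub>i\<close> far from the support of
  \<open>V\<close> and \<open>r\<close>. Since the powers of 3 are lacunary, the corresponding Hankel operator has norm at most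
  \<open>2 / sqrt R\<close>, so the partial sum projections are almost contractive; since they are odd, the
  alternating sum of the \<open>Z\<^sub>j\<close> is \<open>\<delta>\<close> times that of the \<open>e\<^sub>j\<close>, up to boundary terms. Hence the
  normalised alternating vector \<open>\<rho>\<close> is almost in the span of the \<open>Z\<^sub>j\<close> although its inner products
  with them are tiny, and rotating \<open>\<rho>\<close> to \<open>r\<close> destroys non-negativity so little that it can be
  restored by a small perturbation. Applying this to the remainders of a countable family
  with dense span, with factors of product at most \<open>1 + \<epsilon>\<close>, gives the basis.\<close>

section \<open>Lacunary convolution\<close>

text \<open>The right shift by \<open>k\<close>, padded with zeros. The guard matters: truncated
  subtraction would otherwise repeat \<open>A 0\<close> on the first \<open>k\<close>
  positions.\<close>

definition shift :: "nat \<Rightarrow> (nat \<Rightarrow> real) \<Rightarrow> nat \<Rightarrow> real" where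
  "shift k A i = (if k \<le> i then A (i - k) else 0)"

lemma sum_of_bool_unique_le_1:
  assumes "finite I" "\<And>r s. P r \<Longrightarrow> P s \<Longrightarrow> r = s"
  shows "(\<Sum>r\<in>I. if P r then 1 else 0) \<le> (1::real)"
proof (cases "\<exists>r\<in>I. P r")
  case True
  then obtain r where r: "r \<in> I" "P r" by blast
  have "(\<Sum>r\<in>I. if P r then 1 else 0) = (\<Sum>s\<in>I. if s = r then 1 else (0::real))"
    by (rule sum.cong) (use assms r in auto)
  then show ?thesis using assms r by simp
next
  case False
  then have "(\<Sum>r\<in>I. if P r then 1 else 0) = (\<Sum>s\<in>I. (0::real))"
    by (intro sum.cong) auto
  then show ?thesis by simp
qed

lemma square_sum_orthogonal:
  fixes f :: "'a \<Rightarrow> real"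
  assumes "finite I" "\<And>r s. r \<in> I \<Longrightarrow> s \<in> I \<Longrightarrow> r \<noteq> s \<Longrightarrow> f r * f s = 0"
  shows "(\<Sum>r\<in>I. f r)\<^sup>2 = (\<Sum>r\<in>I. (f r)\<^sup>2)"
  using assms
proof (induction I rule: finite_induct)
  case (insert x I)
  have "f x * (\<Sum>r\<in>I. f r) = (\<Sum>r\<in>I. f x * f r)" by (simp add: sum_distrib_left)
  also have "\<dots> = 0" using insert by (intro sum.neutral) auto
  finally show ?case using insert by (simp add: power2_sum)
qed simp

lemma sum_square_shift_le:
  "(\<Sum>i<L. (shift k A i)\<^sup>2) \<le> (\<Sum>i<L. (A i)\<^sup>2)"
proof -
  have "(\<Sum>i<L. (shift k A i)\<^sup>2) = (\<Sum>i\<in>{k..<L}. (A (i - k))\<^sup>2)"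
    by (rule sum.mono_neutral_cong_right) (auto simp: shift_def)
  also have "\<dots> = (\<Sum>i<L - k. (A i)\<^sup>2)"
    by (rule sum.reindex_bij_witness[where i="\<lambda>i. i + k" and j="\<lambda>i. i - k"]) auto
  also have "\<dots> \<le> (\<Sum>i<L. (A i)\<^sup>2)"
    by (rule sum_mono2) auto
  finally show ?thesis .
qed

text \<open>Distinct powers of 3 differ by a factor of at least 3, while two numbers in
  \<open>[p, 2 * p)\<close> have a ratio below 2. The base 3 also makes all shifts odd, which the
  alternating vector exploits later.\<close>

lemma power_3_unique:
  fixes r s p :: nat
  assumes "p \<le> 3 ^ r" "(3::nat) ^ r < 2 * p" "p \<le> 3 ^ s" "(3::nat) ^ s < 2 * p"
  shows "r = s"
proof (rule ccontr)
  have *: False if "p \<le> 3 ^ r" "(3::nat) ^ s < 2 * p" "r < s" for r s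
  proof -
    have "(3::nat) ^ Suc r \<le> 3 ^ s" using that by (intro power_increasing) auto
    then show False using that by simp
  qed
  assume "r \<noteq> s"
  then show False using * assms by (meson nat_neq_iff)
qed

text \<open>A Hankel operator with a lacunary symbol has norm of order \<open>sqrt R\<close> rather than \<open>R\<close>. Moving
  the entry \<open>s < m\<close> to \<open>i = s + 3 ^ r \<ge> m\<close>, the power \<open>3 ^ r\<close> is determined by whichever of \<open>s\<close> and \<open>i\<close>
  is farther from \<open>m\<close>.\<close>
lemma lacunary_hankel_bound:
  assumes A0: "\<And>i. i \<ge> m \<Longrightarrow> A i = 0"
  shows "(\<Sum>i\<in>{m..<L}. (\<Sum>r<R. shift (3 ^ r) A i)\<^sup>2) \<le> 4 * real R * (\<Sum>i<m. (A i)\<^sup>2)"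
proof -
  \<comment> \<open>With \<open>s = i - 3 ^ r < m\<close> one has
    \<open>3 ^ r = (i - m) + (m - s)\<close>. So \<open>xa\<close> holds the terms with
    \<open>i - m < m - s\<close>, where \<open>3 ^ r\<close> lies in
    \<open>[m - s, 2 * (m - s))\<close>, and \<open>xb\<close> holds the others.\<close>
  define xa where "xa r i = (if 2 * (i - m) + 1 \<le> 3 ^ r then shift (3 ^ r) A i else 0)" for r i :: nat
  define xb where "xb r i = (if 2 * (i - m) + 1 \<le> 3 ^ r then 0 else shift (3 ^ r) A i)" for r i :: nat
  have pointwise: "(\<Sum>r<R. shift (3 ^ r) A i)\<^sup>2 \<le> 2 * (real R * (\<Sum>r<R. (xa r i)\<^sup>2)) + 2 * (\<Sum>r<R. (xb r i)\<^sup>2)"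
    if "i \<ge> m" for i
  proof -
    have "(\<Sum>r<R. shift (3 ^ r) A i) = (\<Sum>r<R. xa r i) + (\<Sum>r<R. xb r i)"
      unfolding sum.distrib[symmetric] by (rule sum.cong) (auto simp: xa_def xb_def)
    then have "(\<Sum>r<R. shift (3 ^ r) A i)\<^sup>2 \<le> 2 * (\<Sum>r<R. xa r i)\<^sup>2 + 2 * (\<Sum>r<R. xb r i)\<^sup>2"
      using sum_squares_bound[of "\<Sum>r<R. xa r i" "\<Sum>r<R. xb r i"] by (simp add: power2_sum)
    moreover have "(\<Sum>r<R. xa r i)\<^sup>2 \<le> real R * (\<Sum>r<R. (xa r i)\<^sup>2)"
      using sum_squared_le_sum_of_squares[of "\<lambda>r. xa r i" "{..<R}"] by (simp add: mult.commute)
    moreover have "(\<Sum>r<R. xb r i)\<^sup>2 = (\<Sum>r<R. (xb r i)\<^sup>2)"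
    proof (rule square_sum_orthogonal)
      fix r s :: nat assume "r \<noteq> s"
      \<comment> \<open>A nonzero entry needs \<open>i - 3 ^ r < m\<close>, that is
        \<open>3 ^ r \<ge> i - m + 1\<close>; hence the window starts at \<open>i - m + 1\<close>.
        For fixed \<open>i\<close> at most one \<open>r\<close> survives, so there are no cross
        terms.\<close>
      have nz: "i - m + 1 \<le> 3 ^ r \<and> 3 ^ r < 2 * (i - m + 1)" if "xb r i \<noteq> 0" for r
      proof -
        have "3 ^ r \<le> 2 * (i - m)" and "shift (3 ^ r) A i \<noteq> 0"
          using that by (auto simp: xb_def split: if_splits)
        moreover from this have "i < m + 3 ^ r"
          using A0[of "i - 3 ^ r"] by (force simp: shift_def split: if_splits)
        ultimately show ?thesis using \<open>i \<ge> m\<close> by auto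
      qed
      show "xb r i * xb s i = 0"
        using nz[of r] nz[of s] power_3_unique[of "i - m + 1" r s] \<open>r \<noteq> s\<close> by auto
    qed simp
    ultimately show ?thesis by linarith
  qed
  \<comment> \<open>For \<open>xb\<close> the factor \<open>R\<close> arises from adding up
    \<open>R\<close> shifts, each of them contractive.\<close>
  have b: "(\<Sum>i\<in>{m..<L}. \<Sum>r<R. (xb r i)\<^sup>2) \<le> real R * (\<Sum>i<m. (A i)\<^sup>2)"
  proof -
    have "(\<Sum>i\<in>{m..<L}. (xb r i)\<^sup>2) \<le> (\<Sum>i<m. (A i)\<^sup>2)" for r
    proof -
      have "(\<Sum>i\<in>{m..<L}. (xb r i)\<^sup>2) \<le> (\<Sum>i\<in>{m..<L}. (shift (3 ^ r) A i)\<^sup>2)"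
        by (rule sum_mono) (auto simp: xb_def)
      also have "\<dots> \<le> (\<Sum>i<L. (shift (3 ^ r) A i)\<^sup>2)" by (rule sum_mono2) auto
      also have "\<dots> \<le> (\<Sum>i<L. (A i)\<^sup>2)" by (rule sum_square_shift_le)
      also have "\<dots> = (\<Sum>i\<in>{..<L} \<inter> {..<m}. (A i)\<^sup>2)"
        by (rule sum.mono_neutral_right) (auto intro: A0)
      also have "\<dots> \<le> (\<Sum>i<m. (A i)\<^sup>2)" by (rule sum_mono2) auto
      finally show ?thesis .
    qed
    then have "(\<Sum>r<R. \<Sum>i\<in>{m..<L}. (xb r i)\<^sup>2) \<le> (\<Sum>r<R. \<Sum>i<m. (A i)\<^sup>2)"
      by (intro sum_mono)
    then show ?thesis by (subst sum.swap) simp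
  qed
  \<comment> \<open>For \<open>xa\<close> the factor \<open>R\<close> was already spent on
    Cauchy-Schwarz in \<open>pointwise\<close>. Each source \<open>s\<close> occurs for at most one
    \<open>r\<close>, so summing over \<open>r\<close> costs nothing more.\<close>
  have a: "(\<Sum>i\<in>{m..<L}. \<Sum>r<R. (xa r i)\<^sup>2) \<le> (\<Sum>i<m. (A i)\<^sup>2)"
  proof -
    define P where "P s r \<longleftrightarrow> m - s \<le> 3 ^ r \<and> 3 ^ r < 2 * (m - s)" for s r :: nat
    have "(\<Sum>i\<in>{m..<L}. (xa r i)\<^sup>2) \<le> (\<Sum>s<m. (A s)\<^sup>2 * (if P s r then 1 else 0))" for r
    proof -
      let ?I = "{i\<in>{m..<L}. 2 * (i - m) + 1 \<le> 3 ^ r \<and> 3 ^ r \<le> i \<and> i - 3 ^ r < m}"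
      have "(\<Sum>i\<in>{m..<L}. (xa r i)\<^sup>2) = (\<Sum>i\<in>?I. (A (i - 3 ^ r))\<^sup>2)"
        by (rule sum.mono_neutral_cong_right) (auto simp: xa_def shift_def intro: A0)
      also have "\<dots> = (\<Sum>s\<in>(\<lambda>i. i - 3 ^ r) ` ?I. (A s)\<^sup>2)"
        by (subst sum.reindex) (auto simp: inj_on_def)
      also have "\<dots> = (\<Sum>s\<in>(\<lambda>i. i - 3 ^ r) ` ?I. (A s)\<^sup>2 * (if P s r then 1 else 0))"
        by (rule sum.cong) (auto simp: P_def)
      also have "\<dots> \<le> (\<Sum>s<m. (A s)\<^sup>2 * (if P s r then 1 else 0))"
        by (rule sum_mono2) auto
      finally show ?thesis .
    qed
    then have "(\<Sum>r<R. \<Sum>i\<in>{m..<L}. (xa r i)\<^sup>2) \<le> (\<Sum>r<R. \<Sum>s<m. (A s)\<^sup>2 * (if P s r then 1 else 0))"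
      by (intro sum_mono)
    also have "\<dots> = (\<Sum>s<m. (A s)\<^sup>2 * (\<Sum>r<R. if P s r then 1 else 0))"
      by (subst sum.swap) (simp add: sum_distrib_left)
    also have "\<dots> \<le> (\<Sum>s<m. (A s)\<^sup>2 * 1)"
      by (intro sum_mono mult_left_mono sum_of_bool_unique_le_1)
        (auto simp: P_def intro: power_3_unique)
    finally show ?thesis by (subst sum.swap) simp
  qed
  have "(\<Sum>i\<in>{m..<L}. (\<Sum>r<R. shift (3 ^ r) A i)\<^sup>2)
      \<le> (\<Sum>i\<in>{m..<L}. 2 * (real R * (\<Sum>r<R. (xa r i)\<^sup>2)) + 2 * (\<Sum>r<R. (xb r i)\<^sup>2))"
    by (intro sum_mono pointwise) auto
  also have "\<dots> = 2 * (real R * (\<Sum>i\<in>{m..<L}. \<Sum>r<R. (xa r i)\<^sup>2)) + 2 * (\<Sum>i\<in>{m..<L}. \<Sum>r<R. (xb r i)\<^sup>2)"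
    by (simp add: sum.distrib sum_distrib_left)
  also have "\<dots> \<le> 2 * (real R * (\<Sum>i<m. (A i)\<^sup>2)) + 2 * (real R * (\<Sum>i<m. (A i)\<^sup>2))"
    using a b by (intro add_mono mult_left_mono) auto
  finally show ?thesis by simp
qed

section \<open>Identity plus averaged lacunary shifts, a lower triangular Toeplitz operator\<close>

definition lacunary :: "real \<Rightarrow> nat \<Rightarrow> (nat \<Rightarrow> real) \<Rightarrow> nat \<Rightarrow> real" where
  "lacunary \<theta> R A i = A i + \<theta> / real R * (\<Sum>r<R. shift (3 ^ r) A i)"

lemma lacunary_sum:
  assumes "finite J"
  shows "(\<Sum>j\<in>J. a j * lacunary \<theta> R (B j) i) = lacunary \<theta> R (\<lambda>i. \<Sum>j\<in>J. a j * B j i) i"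
proof -
  have "(\<Sum>r<R. shift (3 ^ r) (\<lambda>i. \<Sum>j\<in>J. a j * B j i) i) = (\<Sum>r<R. \<Sum>j\<in>J. a j * shift (3 ^ r) (B j) i)"
    by (rule sum.cong) (auto simp: shift_def)
  also have "\<dots> = (\<Sum>j\<in>J. \<Sum>r<R. a j * shift (3 ^ r) (B j) i)" by (rule sum.swap)
  finally show ?thesis
    by (simp add: lacunary_def sum.distrib sum_distrib_left algebra_simps)
qed

text \<open>Rows are images of unit vectors, so a partial sum of rows is the image of a truncated
  coefficient sequence. This turns the basis constant of the rows into an estimate for
  truncations.\<close>

lemma lacunary_delta_sum:
  "(\<Sum>j<m. a j * lacunary \<theta> R (\<lambda>i. if i = j then 1 else 0) i)
    = lacunary \<theta> R (\<lambda>i. if i < m then a i else 0) i"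
  by (subst lacunary_sum) (simp_all add: if_distrib cong: if_cong)

lemma L2_set_le_scaled:
  assumes "(\<Sum>i\<in>I. (f i)\<^sup>2) \<le> c\<^sup>2 * (\<Sum>i\<in>J. (g i)\<^sup>2)" "c \<ge> 0"
  shows "L2_set f I \<le> c * L2_set g J"
  using real_sqrt_le_mono[OF assms(1)] assms(2) by (simp add: L2_set_def real_sqrt_mult)

text \<open>An average of contractive shifts is contractive, by Cauchy-Schwarz over the
  \<open>R\<close> shifts.\<close>

lemma lacunary_avg_L2_le:
  assumes "R > 0" "\<theta> \<ge> 0"
  shows "L2_set (\<lambda>i. \<theta> / real R * (\<Sum>r<R. shift (3 ^ r) A i)) {..<L} \<le> \<theta> * L2_set A {..<L}"
proof -
  have "(\<Sum>i<L. (\<Sum>r<R. shift (3 ^ r) A i)\<^sup>2) \<le> (\<Sum>i<L. real R * (\<Sum>r<R. (shift (3 ^ r) A i)\<^sup>2))"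
    using sum_squared_le_sum_of_squares[of "\<lambda>r. shift (3 ^ r) A i" "{..<R}" for i]
    by (intro sum_mono) (simp add: mult.commute)
  also have "\<dots> = real R * (\<Sum>r<R. \<Sum>i<L. (shift (3 ^ r) A i)\<^sup>2)"
    by (subst sum.swap) (simp add: sum_distrib_left)
  also have "\<dots> \<le> real R * (\<Sum>r<R. \<Sum>i<L. (A i)\<^sup>2)"
    by (intro mult_left_mono sum_mono sum_square_shift_le) auto
  finally have "(\<Sum>i<L. (\<Sum>r<R. shift (3 ^ r) A i)\<^sup>2) \<le> (real R)\<^sup>2 * (\<Sum>i<L. (A i)\<^sup>2)"
    by (simp add: power2_eq_square mult.assoc)
  then have "L2_set (\<lambda>i. \<Sum>r<R. shift (3 ^ r) A i) {..<L} \<le> real R * L2_set A {..<L}"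
    by (rule L2_set_le_scaled) simp
  then have "\<theta> / real R * L2_set (\<lambda>i. \<Sum>r<R. shift (3 ^ r) A i) {..<L} \<le> \<theta> / real R * (real R * L2_set A {..<L})"
    using assms by (intro mult_left_mono) auto
  moreover have "L2_set (\<lambda>i. \<theta> / real R * (\<Sum>r<R. shift (3 ^ r) A i)) {..<L}
      = \<theta> / real R * L2_set (\<lambda>i. \<Sum>r<R. shift (3 ^ r) A i) {..<L}"
    using assms by (simp only: L2_set_right_distrib divide_nonneg_nonneg of_nat_0_le_iff)
  ultimately show ?thesis using assms by simp
qed

text \<open>The operator differs from the identity by a perturbation of norm at most
  \<open>\<theta>\<close>; the triangle inequality does the rest.\<close>

lemma lacunary_lower_bound:
  assumes "R > 0" "\<theta> \<ge> 0"
  shows "(1 - \<theta>) * L2_set A {..<L} \<le> L2_set (lacunary \<theta> R A) {..<L}"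
proof -
  let ?s = "\<lambda>i. \<theta> / real R * (\<Sum>r<R. shift (3 ^ r) A i)"
  have "L2_set A {..<L} = L2_set (\<lambda>i. lacunary \<theta> R A i + - ?s i) {..<L}"
    by (rule L2_set_cong) (auto simp: lacunary_def)
  also have "\<dots> \<le> L2_set (lacunary \<theta> R A) {..<L} + L2_set (\<lambda>i. - ?s i) {..<L}"
    by (rule L2_set_triangle_ineq)
  also have "L2_set (\<lambda>i. - ?s i) {..<L} = L2_set ?s {..<L}"
    by (simp add: L2_set_def)
  also have "\<dots> \<le> \<theta> * L2_set A {..<L}" by (rule lacunary_avg_L2_le) fact+
  finally show ?thesis by (simp add: algebra_simps)
qed

text \<open>The initial part of \<open>A\<close> leaks past position \<open>m\<close> only through the Hankel operator, which is
  small in norm.\<close>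
lemma lacunary_initial_part:
  assumes \<theta>: "0 \<le> \<theta>" "\<theta> < 1" and \<eta>: "0 < \<eta>" and R: "R > 0" "2 / sqrt (real R) \<le> (1 - \<theta>) * (\<eta> / (1 + \<eta>))"
    and "m \<le> L"
  shows "L2_set (lacunary \<theta> R (\<lambda>i. if i < m then A i else 0)) {..<L}
    \<le> (1 + \<eta>) * L2_set (lacunary \<theta> R A) {..<L}"
proof -
  define A1 where "A1 = (\<lambda>i. if i < m then A i else 0)"
  \<comment> \<open>The operator only moves entries to the right, so below \<open>m\<close>
    truncating \<open>A\<close> changes nothing; from \<open>m\<close> on only the shifted copies of
    the truncated sequence remain. These two ranges are \<open>p\<close> and
    \<open>q\<close>.\<close>
  define p where "p i = (if i < m then lacunary \<theta> R A i else 0)" for i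
  define q where "q i = (if i < m then 0 else \<theta> / real R * (\<Sum>r<R. shift (3 ^ r) A1 i))" for i
  have "L2_set (lacunary \<theta> R A1) {..<L} = L2_set (\<lambda>i. p i + q i) {..<L}"
    by (rule L2_set_cong)
      (auto simp: p_def q_def lacunary_def A1_def shift_def intro!: sum.cong arg_cong2[of _ _ _ _ "(*)"])
  also have "\<dots> \<le> L2_set p {..<L} + L2_set q {..<L}" by (rule L2_set_triangle_ineq)
  also have "L2_set p {..<L} \<le> L2_set (lacunary \<theta> R A) {..<L}"
    unfolding L2_set_def by (intro real_sqrt_le_mono sum_mono) (auto simp: p_def)
  also have "L2_set q {..<L} \<le> \<eta> / (1 + \<eta>) * L2_set (lacunary \<theta> R A1) {..<L}"
  proof -
    have "(\<Sum>i<L. (q i)\<^sup>2) = (\<Sum>i\<in>{m..<L}. (\<theta> / real R)\<^sup>2 * (\<Sum>r<R. shift (3 ^ r) A1 i)\<^sup>2)"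
      by (rule sum.mono_neutral_cong_right) (auto simp: q_def power_mult_distrib power_divide)
    also have "\<dots> \<le> (\<theta> / real R)\<^sup>2 * (4 * real R * (\<Sum>i<m. (A1 i)\<^sup>2))"
      unfolding sum_distrib_left[symmetric]
      by (intro mult_left_mono lacunary_hankel_bound) (auto simp: A1_def)
    also have "\<dots> \<le> (\<theta> / real R)\<^sup>2 * (4 * real R * (\<Sum>i<L. (A1 i)\<^sup>2))"
      using \<open>m \<le> L\<close> by (intro mult_left_mono sum_mono2) auto
    also have "\<dots> \<le> (1 / real R)\<^sup>2 * (4 * real R * (\<Sum>i<L. (A1 i)\<^sup>2))"
      using \<theta> by (intro mult_right_mono power_mono divide_right_mono) (auto intro!: sum_nonneg mult_nonneg_nonneg)
    also have "\<dots> = (2 / sqrt (real R))\<^sup>2 * (\<Sum>i<L. (A1 i)\<^sup>2)"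
      using R by (simp add: power_divide power2_eq_square)
    finally have "L2_set q {..<L} \<le> 2 / sqrt (real R) * L2_set A1 {..<L}"
      by (rule L2_set_le_scaled) simp
    also have "\<dots> \<le> \<eta> / (1 + \<eta>) * ((1 - \<theta>) * L2_set A1 {..<L})"
      using mult_right_mono[OF R(2), of "L2_set A1 {..<L}"] by (simp add: mult_ac)
    also have "\<dots> \<le> \<eta> / (1 + \<eta>) * L2_set (lacunary \<theta> R A1) {..<L}"
      using \<eta> \<theta> R by (intro mult_left_mono lacunary_lower_bound) auto
    finally show ?thesis .
  qed
  \<comment> \<open>The leak is bounded by a multiple of the left side itself and is absorbed there.
    The fraction \<open>\<eta> / (1 + \<eta>)\<close> is chosen to leave exactly the factor
    \<open>1 / (1 + \<eta>)\<close>.\<close>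
  finally have "L2_set (lacunary \<theta> R A1) {..<L} * (1 - \<eta> / (1 + \<eta>)) \<le> L2_set (lacunary \<theta> R A) {..<L}"
    by (simp add: algebra_simps)
  moreover have "1 - \<eta> / (1 + \<eta>) = 1 / (1 + \<eta>)" using \<eta> by (simp add: field_simps)
  ultimately show ?thesis using \<eta> by (simp add: A1_def field_simps)
qed

section \<open>Row sums and the action on the alternating vector\<close>

lemma sum_mult_lacunary_delta:
  assumes "j + 3 ^ R \<le> L" "R > 0"
  shows "(\<Sum>i<L. c i * lacunary \<theta> R (\<lambda>i. if i = j then 1 else 0) i)
    = c j + \<theta> / real R * (\<Sum>r<R. c (j + 3 ^ r))"
proof -
  \<comment> \<open>The shifts stop at \<open>3 ^ (R - 1)\<close>, so no entry of row
    \<open>j\<close> is cut off at \<open>L\<close>.\<close>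
  have lt: "j + 3 ^ r < L" if "r < R" for r
  proof -
    have "(3::nat) ^ r < 3 ^ R" using that by simp
    then show ?thesis using assms(1) by linarith
  qed
  have jL: "j < L" using lt[OF assms(2)] by simp
  have "(\<Sum>i<L. c i * shift (3 ^ r) (\<lambda>i. if i = j then 1 else 0) i) = c (j + 3 ^ r)" if "r < R" for r
  proof -
    have "(\<Sum>i<L. c i * shift (3 ^ r) (\<lambda>i. if i = j then 1 else 0) i)
      = (\<Sum>i<L. if i = j + 3 ^ r then c i else 0)"
      by (rule sum.cong) (auto simp: shift_def)
    then show ?thesis using lt[OF that] by simp
  qed
  then have "(\<Sum>r<R. \<Sum>i<L. c i * shift (3 ^ r) (\<lambda>i. if i = j then 1 else 0) i) = (\<Sum>r<R. c (j + 3 ^ r))"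
    by simp
  moreover have "(\<Sum>i<L. c i * lacunary \<theta> R (\<lambda>i. if i = j then 1 else 0) i)
    = (\<Sum>i<L. if i = j then c i else 0)
     + \<theta> / real R * (\<Sum>i<L. \<Sum>r<R. c i * shift (3 ^ r) (\<lambda>i. if i = j then 1 else 0) i)"
    unfolding sum_distrib_left sum.distrib[symmetric]
    by (rule sum.cong) (auto simp: lacunary_def sum_distrib_left algebra_simps)
  ultimately show ?thesis using jL by (simp add: sum.swap[of _ _ "{..<L}"])
qed

lemma sum_alternating_even: "even n \<Longrightarrow> (\<Sum>j<n. (-1) ^ j) = (0::real)"
proof -
  have "(\<Sum>j<2 * k. (-1) ^ j) = (0::real)" for k by (induction k) auto
  then show "even n \<Longrightarrow> ?thesis" by (auto elim: evenE)
qed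

text \<open>Odd shifts reverse the sign of an alternating sequence, so away from the ends the
  operator multiplies it by \<open>1 - (1 - \<delta>) = \<delta>\<close>, which the factor
  \<open>1 / \<delta>\<close> compensates. At most \<open>2 * 3 ^ R\<close> boundary positions
  remain, each with an error of at most \<open>3 / (\<delta> * sqrt L)\<close>; hence the constant
  18.\<close>

lemma L2_set_lacunary_alternating:
  assumes \<delta>: "0 < \<delta>" "\<delta> < 1" and "R > 0" and L: "L = n + 3 ^ R"
  shows "(L2_set (\<lambda>i. lacunary (1 - \<delta>) R (\<lambda>i. if i < n then (-1) ^ i / (\<delta> * sqrt (real L)) else 0) i
      - (-1) ^ i / sqrt (real L)) {..<L})\<^sup>2 \<le> 18 * 3 ^ R / (\<delta>\<^sup>2 * real L)"
proof -
  define s where "s = sqrt (real L)"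
  define B where "B i = (if i < n then (-1) ^ i / (\<delta> * s) else 0)" for i
  define d where "d i = lacunary (1 - \<delta>) R B i - (-1) ^ i / s" for i
  have s: "s > 0" "s\<^sup>2 = real L" by (auto simp: s_def L add_nonneg_pos)
  have le: "(3::nat) ^ r \<le> 3 ^ R" if "r < R" for r using that by (intro power_increasing) auto
  have bulk: "d i = 0" if "3 ^ R \<le> i" "i < n" for i
  proof -
    have "(\<Sum>r<R. shift (3 ^ r) B i) = (\<Sum>r<R. - ((-1) ^ i / (\<delta> * s)))"
    proof (rule sum.cong)
      fix r assume "r \<in> {..<R}"
      then have "r < R" by simp
      from order_trans[OF le[OF this] that(1)] have "3 ^ r \<le> i" .
      then obtain k where "i = k + 3 ^ r" by (metis add.commute le_Suc_ex)
      then show "shift (3 ^ r) B i = - ((-1) ^ i / (\<delta> * s))"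
        using that by (simp add: shift_def B_def power_add)
    qed simp
    then show ?thesis using that \<delta> s \<open>R > 0\<close> by (simp add: d_def lacunary_def B_def field_simps)
  qed
  have bnd: "\<bar>d i\<bar> \<le> 3 / (\<delta> * s)" for i
  proof -
    have B: "\<bar>B i\<bar> \<le> 1 / (\<delta> * s)" for i using \<delta> s by (auto simp: B_def)
    have sh: "\<bar>shift k B i\<bar> \<le> 1 / (\<delta> * s)" for k using B \<delta> s by (auto simp: shift_def)
    have "\<bar>\<Sum>r<R. shift (3 ^ r) B i\<bar> \<le> (\<Sum>r<R. 1 / (\<delta> * s))"
      by (rule order_trans[OF sum_abs]) (intro sum_mono sh)
    then have "\<bar>(1 - \<delta>) / real R * (\<Sum>r<R. shift (3 ^ r) B i)\<bar> \<le> (1 - \<delta>) / real R * (real R * (1 / (\<delta> * s)))"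
      using \<delta> unfolding abs_mult by (intro mult_mono) auto
    also have "\<dots> = (1 - \<delta>) * (1 / (\<delta> * s))" using \<open>R > 0\<close> by simp
    also have "\<dots> \<le> 1 * (1 / (\<delta> * s))" using \<delta> s by (intro mult_right_mono) auto
    finally have "\<bar>(1 - \<delta>) / real R * (\<Sum>r<R. shift (3 ^ r) B i)\<bar> \<le> 1 / (\<delta> * s)" by simp
    moreover have "\<bar>(-1) ^ i / s\<bar> \<le> 1 / (\<delta> * s)" using \<delta> s by (simp add: power_abs field_simps)
    moreover have "3 / (\<delta> * s) = 1 / (\<delta> * s) + 1 / (\<delta> * s) + 1 / (\<delta> * s)" by simp
    ultimately show ?thesis using B[of i] unfolding d_def lacunary_def by linarith
  qed
  have "(\<Sum>i<L. (d i)\<^sup>2) = (\<Sum>i\<in>{..<3 ^ R} \<union> {n..<L}. (d i)\<^sup>2)"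
  proof (rule sum.mono_neutral_right)
    show "\<forall>i\<in>{..<L} - ({..<3 ^ R} \<union> {n..<L}). (d i)\<^sup>2 = 0"
    proof
      fix i assume "i \<in> {..<L} - ({..<3 ^ R} \<union> {n..<L})"
      then have "3 ^ R \<le> i" "i < n" by (auto simp: not_less)
      then show "(d i)\<^sup>2 = 0" using bulk by simp
    qed
  qed (auto simp: L)
  also have "\<dots> \<le> (\<Sum>i\<in>{..<3 ^ R} \<union> {n..<L}. (3 / (\<delta> * s))\<^sup>2)"
    by (intro sum_mono abs_le_square_iff[THEN iffD1]) (use bnd \<delta> s in auto)
  also have "\<dots> \<le> real (3 ^ R + 3 ^ R) * (3 / (\<delta> * s))\<^sup>2"
  proof -
    have "card ({..<3 ^ R} \<union> {n..<L}) \<le> 3 ^ R + 3 ^ R"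
      using card_Un_le[of "{..<3 ^ R}" "{n..<L}"] by (simp add: L)
    then show ?thesis by (simp del: of_nat_add add: mult_right_mono)
  qed
  also have "\<dots> = 18 * 3 ^ R / (\<delta>\<^sup>2 * real L)"
    using s \<delta> by (simp add: power_divide power_mult_distrib)
  finally show ?thesis unfolding d_def B_def s_def L2_set_def by (simp add: sum_nonneg)
qed

text \<open>The rows \<open>Z j\<close> are the translates of \<open>e\<^sub>0 + (1 - \<delta>) / R * (\<Sum>r<R. e\<^bsub>3 ^ r\<^esub>)\<close>.\<close>
lemma nonneg_rows_with_small_alternating_sum:
  fixes \<delta> \<eta> e :: real
  assumes \<delta>: "0 < \<delta>" "\<delta> < 1" and "0 < \<eta>" and "0 < e"
  obtains n L :: nat and Z :: "nat \<Rightarrow> nat \<Rightarrow> real" and b :: "nat \<Rightarrow> real"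
  where "n > 0" "L > 0" "\<And>j i. Z j i \<ge> 0"
    "\<And>j. j < n \<Longrightarrow> (\<Sum>i<L. Z j i) = 2 - \<delta>"
    "\<And>j. j < n \<Longrightarrow> (\<Sum>i<L. (-1) ^ i * Z j i) = (-1) ^ j * \<delta>"
    "\<And>a m. m \<le> n \<Longrightarrow> L2_set (\<lambda>i. \<Sum>j<m. a j * Z j i) {..<L} \<le> (1 + \<eta>) * L2_set (\<lambda>i. \<Sum>j<n. a j * Z j i) {..<L}"
    "(\<Sum>j<n. b j) = 0"
    "L2_set (\<lambda>i. (\<Sum>j<n. b j * Z j i) - (-1) ^ i / sqrt (real L)) {..<L} \<le> e"
proof -
  define \<theta> where "\<theta> = 1 - \<delta>"
  \<comment> \<open>This makes \<open>2 / sqrt R \<le> \<delta> * (\<eta> / (1 + \<eta>))\<close>,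
    as \<open>lacunary_initial_part\<close> demands.\<close>
  define R where "R = nat \<lceil>(2 / (\<delta> * (\<eta> / (1 + \<eta>))))\<^sup>2\<rceil> + 1"
  \<comment> \<open>Chosen after \<open>R\<close>: large, so that the boundary error
    \<open>18 * 3 ^ R / (\<delta>\<^sup>2 * L)\<close> is at most \<open>e\<^sup>2\<close>, and
    even, so that the alternating coefficients \<open>b\<close> sum to 0.\<close>
  define n where "n = 2 * (nat \<lceil>18 * 3 ^ R / (\<delta>\<^sup>2 * e\<^sup>2)\<rceil> + 1)"
  define L where "L = n + 3 ^ R"
  define Z where "Z j = lacunary \<theta> R (\<lambda>i. if i = j then 1 else 0)" for j
  define b where "b j = (-1) ^ j / (\<delta> * sqrt (real L))" for j :: nat
  have \<theta>: "0 \<le> \<theta>" "\<theta> < 1" "1 - \<theta> = \<delta>" using \<delta> by (auto simp: \<theta>_def)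
  have ceil: "x \<le> real (nat \<lceil>x\<rceil> + 1)" for x :: real
    using real_nat_ceiling_ge[of x] by linarith
  have ceil2: "x \<le> real (2 * (nat \<lceil>x\<rceil> + 1))" for x :: real
  proof -
    have "k \<le> 2 * (k + 1)" for k :: nat by simp
    then show ?thesis by (rule order_trans[OF real_nat_ceiling_ge of_nat_mono])
  qed
  have "R > 0" by (simp add: R_def)
  have R: "2 / sqrt (real R) \<le> (1 - \<theta>) * (\<eta> / (1 + \<eta>))"
  proof -
    define c where "c = \<delta> * (\<eta> / (1 + \<eta>))"
    have "c > 0" using assms by (simp add: c_def)
    have "(2 / c)\<^sup>2 \<le> real R"
      unfolding R_def c_def[symmetric] by (rule ceil)
    then have "2 / c \<le> sqrt (real R)" by (rule real_le_rsqrt)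
    moreover have "sqrt (real R) > 0" using \<open>R > 0\<close> by simp
    ultimately have "2 / sqrt (real R) \<le> c" using \<open>c > 0\<close>
      by (simp add: pos_divide_le_eq mult.commute)
    then show ?thesis unfolding c_def \<theta>(3) .
  qed
  note R = \<open>R > 0\<close> R
  have n: "n > 0" "even n" by (auto simp: n_def)
  have n3: "18 * 3 ^ R / (\<delta>\<^sup>2 * e\<^sup>2) \<le> real n"
    unfolding n_def by (rule ceil2)
  have comb: "(\<Sum>j<m. a j * Z j i) = lacunary \<theta> R (\<lambda>i. if i < m then a i else 0) i" for a m i
    unfolding Z_def by (rule lacunary_delta_sum)
  have jL: "j + 3 ^ R \<le> L" if "j < n" for j using that by (simp add: L_def)
  show thesis
  proof
    show "n > 0" by (rule n)
    show "L > 0" by (simp add: L_def)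
    show "Z j i \<ge> 0" for j i
      unfolding Z_def lacunary_def using \<theta>
      by (intro add_nonneg_nonneg mult_nonneg_nonneg sum_nonneg) (auto simp: shift_def)
    show "(\<Sum>i<L. Z j i) = 2 - \<delta>" if "j < n" for j
      using sum_mult_lacunary_delta[OF jL[OF that] R(1), of "\<lambda>_. 1" \<theta>] R(1)
      by (simp add: Z_def \<theta>_def)
    show "(\<Sum>i<L. (-1) ^ i * Z j i) = (-1) ^ j * \<delta>" if "j < n" for j
    proof -
      have "(\<Sum>r<R. (-1) ^ (j + 3 ^ r)) = (\<Sum>r<R. - ((-1::real) ^ j))"
        by (rule sum.cong) (simp_all add: power_add)
      then show ?thesis
        using sum_mult_lacunary_delta[OF jL[OF that] R(1), of "\<lambda>i. (-1) ^ i" \<theta>] R(1)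
        by (simp add: Z_def \<theta>_def field_simps)
    qed
    show "L2_set (\<lambda>i. \<Sum>j<m. a j * Z j i) {..<L} \<le> (1 + \<eta>) * L2_set (\<lambda>i. \<Sum>j<n. a j * Z j i) {..<L}"
      if "m \<le> n" for a m
    proof -
      have "(\<lambda>i. if i < m then if i < n then a i else 0 else 0) = (\<lambda>i. if i < m then a i else 0)"
        using that by auto
      then show ?thesis
        unfolding comb
        using lacunary_initial_part[OF \<theta>(1,2) \<open>0 < \<eta>\<close> R, of m L "\<lambda>i. if i < n then a i else 0"] that
        by (simp add: L_def)
    qed
    show "(\<Sum>j<n. b j) = 0"
      unfolding b_def sum_divide_distrib[symmetric] using sum_alternating_even[OF n(2)] by simp
    have "18 * 3 ^ R / (\<delta>\<^sup>2 * real L) \<le> e\<^sup>2"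
    proof -
      have "real L > 0" using n(1) by (simp add: L_def add_pos_pos)
      have "18 * 3 ^ R / (\<delta>\<^sup>2 * e\<^sup>2) \<le> real L" using n3 by (simp add: L_def add_increasing2)
      then show ?thesis using \<open>real L > 0\<close> \<delta> \<open>0 < e\<close> by (simp add: field_simps)
    qed
    then have "(L2_set (\<lambda>i. (\<Sum>j<n. b j * Z j i) - (-1) ^ i / sqrt (real L)) {..<L})\<^sup>2 \<le> e\<^sup>2"
      unfolding comb b_def \<theta>_def
      using L2_set_lacunary_alternating[OF \<delta> R(1) L_def] by linarith
    then show "L2_set (\<lambda>i. (\<Sum>j<n. b j * Z j i) - (-1) ^ i / sqrt (real L)) {..<L} \<le> e"
      using \<open>0 < e\<close> by (simp add: power2_le_iff_abs_le)
  qed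
qed

section \<open>The Hilbert space structure of L2\<close>

definition ip :: "(real \<Rightarrow> real) \<Rightarrow> (real \<Rightarrow> real) \<Rightarrow> real" where
  "ip f g = (LINT x|lborel. f x * g x)"

lemma L2_measurable [measurable_dest]: "f \<in> L2 \<Longrightarrow> f \<in> borel_measurable lborel"
  by (simp add: L2_def)

lemma L2_square_integrable: "f \<in> L2 \<Longrightarrow> integrable lborel (\<lambda>x. (f x)\<^sup>2)"
  by (simp add: L2_def)

lemma L2_mult_integrable:
  assumes [measurable]: "f \<in> L2" "g \<in> L2"
  shows "integrable lborel (\<lambda>x. f x * g x)"
proof (rule Bochner_Integration.integrable_bound)
  show "integrable lborel (\<lambda>x. (f x)\<^sup>2 + (g x)\<^sup>2)"
    using assms by (intro Bochner_Integration.integrable_add L2_square_integrable)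
  have "\<bar>a * b\<bar> \<le> a\<^sup>2 + b\<^sup>2" for a b :: real
    using sum_squares_bound[of a b] sum_squares_bound[of a "- b"] by (simp add: abs_le_iff)
  then show "AE x in lborel. norm (f x * g x) \<le> norm ((f x)\<^sup>2 + (g x)\<^sup>2)" by simp
qed measurable

lemma L2_dominated:
  assumes [measurable]: "g \<in> borel_measurable lborel" and "f \<in> L2" and "\<And>x. \<bar>g x\<bar> \<le> \<bar>f x\<bar>"
  shows "g \<in> L2"
  unfolding L2_def
proof (intro CollectI conjI)
  show "integrable lborel (\<lambda>x. (g x)\<^sup>2)"
    by (rule Bochner_Integration.integrable_bound[OF L2_square_integrable[OF assms(2)]])
      (use assms in \<open>auto simp: abs_le_square_iff[symmetric]\<close>)
qed fact

lemma L2_add [intro, simp]: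
  assumes [measurable]: "f \<in> L2" "g \<in> L2" shows "(\<lambda>x. f x + g x) \<in> L2"
proof -
  have "integrable lborel (\<lambda>x. (f x)\<^sup>2 + (g x)\<^sup>2 + 2 * (f x * g x))"
    using assms by (intro Bochner_Integration.integrable_add L2_square_integrable integrable_mult_right L2_mult_integrable)
  moreover have "(\<lambda>x. f x + g x) \<in> borel_measurable lborel" by measurable
  ultimately show ?thesis by (simp add: L2_def power2_sum mult.assoc)
qed

lemma L2_cmult [intro, simp]: "f \<in> L2 \<Longrightarrow> (\<lambda>x. c * f x) \<in> L2"
  by (auto simp: L2_def power_mult_distrib)

lemma L2_diff [intro, simp]: "f \<in> L2 \<Longrightarrow> g \<in> L2 \<Longrightarrow> (\<lambda>x. f x - g x) \<in> L2"
  using L2_add[of f "\<lambda>x. -1 * g x"] L2_cmult[of g "-1"] by simp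

lemma L2_zero [intro, simp]: "(\<lambda>x. 0) \<in> L2"
  by (simp add: L2_def)

lemma L2_sum [intro, simp]: "(\<And>i. i \<in> I \<Longrightarrow> f i \<in> L2) \<Longrightarrow> (\<lambda>x. \<Sum>i\<in>I. f i x) \<in> L2"
  by (induction I rule: infinite_finite_induct) auto

lemma L2_abs [intro, simp]: "f \<in> L2 \<Longrightarrow> (\<lambda>x. \<bar>f x\<bar>) \<in> L2"
  by (auto simp: L2_def)

lemma L2_indicator: "A \<in> sets borel \<Longrightarrow> emeasure lborel A < \<infinity> \<Longrightarrow> indicator A \<in> L2"
proof -
  assume A: "A \<in> sets borel" "emeasure lborel A < \<infinity>"
  have "(\<lambda>x. (indicator A x :: real)\<^sup>2) = indicator A" by (auto simp: indicator_def)
  with A show ?thesis by (simp add: L2_def)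
qed

lemma L2_indicator_Icc [intro, simp]: "indicator {a..b} \<in> L2"
  by (rule L2_indicator) (auto simp: emeasure_lborel_Icc_eq)

lemma ip_commute: "ip f g = ip g f"
  by (simp add: ip_def mult.commute)

lemma ip_add_left [simp]: "f \<in> L2 \<Longrightarrow> g \<in> L2 \<Longrightarrow> h \<in> L2 \<Longrightarrow> ip (\<lambda>x. f x + g x) h = ip f h + ip g h"
  by (simp add: ip_def L2_mult_integrable distrib_right)

lemma ip_diff_left [simp]: "f \<in> L2 \<Longrightarrow> g \<in> L2 \<Longrightarrow> h \<in> L2 \<Longrightarrow> ip (\<lambda>x. f x - g x) h = ip f h - ip g h"
  by (simp add: ip_def L2_mult_integrable left_diff_distrib)

lemma ip_cmult_left [simp]: "ip (\<lambda>x. c * f x) h = c * ip f h"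
  by (simp add: ip_def mult.assoc)

lemma ip_sum_left [simp]:
  "(\<And>i. i \<in> I \<Longrightarrow> f i \<in> L2) \<Longrightarrow> h \<in> L2 \<Longrightarrow> ip (\<lambda>x. \<Sum>i\<in>I. f i x) h = (\<Sum>i\<in>I. ip (f i) h)"
  by (simp add: ip_def L2_mult_integrable sum_distrib_right Bochner_Integration.integral_sum)

lemma ip_add_right [simp]: "f \<in> L2 \<Longrightarrow> g \<in> L2 \<Longrightarrow> h \<in> L2 \<Longrightarrow> ip h (\<lambda>x. f x + g x) = ip h f + ip h g"
  by (simp add: ip_commute[of h])

lemma ip_diff_right [simp]: "f \<in> L2 \<Longrightarrow> g \<in> L2 \<Longrightarrow> h \<in> L2 \<Longrightarrow> ip h (\<lambda>x. f x - g x) = ip h f - ip h g"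
  by (simp add: ip_commute[of h])

lemma ip_cmult_right [simp]: "ip h (\<lambda>x. c * f x) = c * ip h f"
  by (simp add: ip_commute[of h])

lemma ip_sum_right [simp]:
  "(\<And>i. i \<in> I \<Longrightarrow> f i \<in> L2) \<Longrightarrow> h \<in> L2 \<Longrightarrow> ip h (\<lambda>x. \<Sum>i\<in>I. f i x) = (\<Sum>i\<in>I. ip h (f i))"
  by (simp add: ip_commute[of h])

lemma ip_disjoint_support:
  assumes "\<And>x. f x = 0 \<or> g x = 0" shows "ip f g = 0"
proof -
  have "(\<lambda>x. f x * g x) = (\<lambda>x. 0)" using assms by auto
  then show ?thesis by (simp add: ip_def)
qed

lemma ip_self_nonneg: "0 \<le> ip f f"
  by (simp add: ip_def)

lemma L2norm_nonneg [simp]: "0 \<le> L2norm f"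
  by (simp add: L2norm_def)

lemma L2norm_power2: "(L2norm f)\<^sup>2 = ip f f"
  by (simp add: L2norm_def ip_def power2_eq_square)

lemma L2norm_cmult: "L2norm (\<lambda>x. c * f x) = \<bar>c\<bar> * L2norm f"
  by (simp add: L2norm_def power_mult_distrib real_sqrt_mult)

lemma L2norm_zero [simp]: "L2norm (\<lambda>x. 0) = 0"
  by (simp add: L2norm_def)

lemma L2norm_minus_commute: "L2norm (\<lambda>x. f x - g x) = L2norm (\<lambda>x. g x - f x)"
  by (simp add: L2norm_def power2_commute)

lemma L2_Cauchy_Schwarz:
  assumes [simp]: "f \<in> L2" "g \<in> L2"
  shows "\<bar>ip f g\<bar> \<le> L2norm f * L2norm g"
proof -
  have nonneg: "0 \<le> ip f f - 2 * s * ip f g + s\<^sup>2 * ip g g" for s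
    using ip_self_nonneg[of "\<lambda>x. f x - s * g x"]
    by (simp add: ip_commute[of g f] power2_eq_square algebra_simps)
  have "(ip f g)\<^sup>2 \<le> ip f f * ip g g"
  proof (cases "ip g g = 0")
    case True
    have "ip f g = 0"
    proof (rule ccontr)
      assume "ip f g \<noteq> 0"
      \<comment> \<open>If \<open>ip g g = 0\<close>, the quadratic is linear in \<open>s\<close>,
        and this \<open>s\<close> gives it the value -1.\<close>
      then show False using nonneg[of "(ip f f + 1) / (2 * ip f g)"] True by simp
    qed
    then show ?thesis using True by simp
  next
    case False
    then have "ip g g > 0" using ip_self_nonneg[of g] by simp
    then show ?thesis
      using nonneg[of "ip f g / ip g g"] by (simp add: field_simps power2_eq_square)
  qed
  then have "(ip f g)\<^sup>2 \<le> (L2norm f * L2norm g)\<^sup>2"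
    by (simp add: power_mult_distrib L2norm_power2)
  then show ?thesis by (simp add: abs_le_square_iff[symmetric])
qed

lemma L2norm_triangle:
  assumes [simp]: "f \<in> L2" "g \<in> L2"
  shows "L2norm (\<lambda>x. f x + g x) \<le> L2norm f + L2norm g"
proof (rule power2_le_imp_le)
  have "(L2norm (\<lambda>x. f x + g x))\<^sup>2 = (L2norm f)\<^sup>2 + 2 * ip f g + (L2norm g)\<^sup>2"
    by (simp add: L2norm_power2 ip_commute[of g f])
  also have "\<dots> \<le> (L2norm f + L2norm g)\<^sup>2"
    using L2_Cauchy_Schwarz[of f g] by (simp add: power2_sum)
  finally show "(L2norm (\<lambda>x. f x + g x))\<^sup>2 \<le> (L2norm f + L2norm g)\<^sup>2" .
qed simp

lemma L2norm_triangle_diff: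
  assumes "f \<in> L2" "g \<in> L2" "h \<in> L2"
  shows "L2norm (\<lambda>x. f x - h x) \<le> L2norm (\<lambda>x. f x - g x) + L2norm (\<lambda>x. g x - h x)"
  using L2norm_triangle[of "\<lambda>x. f x - g x" "\<lambda>x. g x - h x"] assms by simp

lemma L2norm_pythagoras:
  assumes "f \<in> L2" "g \<in> L2" "ip f g = 0"
  shows "(L2norm (\<lambda>x. f x + g x))\<^sup>2 = (L2norm f)\<^sup>2 + (L2norm g)\<^sup>2"
  using assms by (simp add: L2norm_power2 ip_commute[of g f])

lemma L2_dominated_convergence:
  assumes [measurable]: "\<And>i. s i \<in> borel_measurable lborel" "f \<in> borel_measurable lborel"
    and w: "w \<in> L2" and bound: "\<And>i x. \<bar>s i x\<bar> \<le> w x" and lim: "\<And>x. (\<lambda>i. s i x) \<longlonglongrightarrow> f x"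
  shows "f \<in> L2" "(\<lambda>i. L2norm (\<lambda>x. f x - s i x)) \<longlonglongrightarrow> 0"
proof -
  have fw: "\<bar>f x\<bar> \<le> w x" for x
    using bound by (intro LIMSEQ_le_const2[OF tendsto_rabs[OF lim]]) auto
  show "f \<in> L2" by (rule L2_dominated[OF _ w]) (auto intro: order_trans[OF fw])
  have "(\<lambda>i. LINT x|lborel. (f x - s i x)\<^sup>2) \<longlonglongrightarrow> (LINT x::real|lborel. 0)"
  \<comment> \<open>The limit obeys the same bound \<open>w\<close>, so the difference is at most
    \<open>2 * w\<close>.\<close>
  proof (rule integral_dominated_convergence[where w="\<lambda>x. 4 * (w x)\<^sup>2"])
    show "integrable lborel (\<lambda>x. 4 * (w x)\<^sup>2)" using L2_square_integrable[OF w] by simp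
    show "AE x in lborel. (\<lambda>i. (f x - s i x)\<^sup>2) \<longlonglongrightarrow> 0"
    proof (rule AE_I2)
      fix x
      have "(\<lambda>i. (f x - s i x)\<^sup>2) \<longlonglongrightarrow> (f x - f x)\<^sup>2"
        by (intro tendsto_intros lim)
      then show "(\<lambda>i. (f x - s i x)\<^sup>2) \<longlonglongrightarrow> 0" by simp
    qed
    show "AE x in lborel. norm ((f x - s i x)\<^sup>2) \<le> 4 * (w x)\<^sup>2" for i
    proof (rule AE_I2)
      fix x
      have "\<bar>f x - s i x\<bar> \<le> 2 * w x" using fw[of x] bound[of i x] by linarith
      then have "(f x - s i x)\<^sup>2 \<le> (2 * w x)\<^sup>2" by (intro abs_le_square_iff[THEN iffD1]) simp
      then show "norm ((f x - s i x)\<^sup>2) \<le> 4 * (w x)\<^sup>2" by (simp add: power_mult_distrib)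
    qed
  qed measurable
  then show "(\<lambda>i. L2norm (\<lambda>x. f x - s i x)) \<longlonglongrightarrow> 0"
    unfolding L2norm_def using tendsto_real_sqrt by fastforce
qed

text \<open>One Gram-Schmidt step per induction step: the remainders of \<open>f\<close> and of
  \<open>z n\<close> modulo the earlier functions are formed, and the first is made orthogonal to
  the second.\<close>

lemma orthogonal_projection_exists:
  fixes n :: nat
  assumes "\<And>j. j < n \<Longrightarrow> z j \<in> L2" "f \<in> L2"
  shows "\<exists>c. \<forall>k<n. ip (\<lambda>t. f t - (\<Sum>j<n. c j * z j t)) (z k) = 0"
  using assms
proof (induction n arbitrary: f)
  case (Suc n)
  note [simp] = Suc.prems
  obtain c where c: "ip (\<lambda>t. f t - (\<Sum>j<n. c j * z j t)) (z k) = 0" if "k < n" for k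
    using Suc.IH[of f] by auto
  obtain d where d: "ip (\<lambda>t. z n t - (\<Sum>j<n. d j * z j t)) (z k) = 0" if "k < n" for k
    using Suc.IH[of "z n"] by auto
  define r where "r = (\<lambda>t. f t - (\<Sum>j<n. c j * z j t))"
  define u where "u = (\<lambda>t. z n t - (\<Sum>j<n. d j * z j t))"
  have [simp]: "r \<in> L2" "u \<in> L2"
    unfolding r_def u_def by (intro L2_diff L2_sum L2_cmult; simp)+
  \<comment> \<open>If \<open>u\<close> has norm 0, division by zero gives \<open>s = 0\<close>.
    This is the right value, since then \<open>ip r u = 0\<close> by Cauchy-Schwarz.\<close>
  define s where "s = ip r u / ip u u"
  define e where "e = (\<lambda>j. c j - s * d j)(n := s)"
  have "(\<lambda>t. f t - (\<Sum>j<Suc n. e j * z j t)) = (\<lambda>t. r t - s * u t)"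
  proof
    fix t
    have "(\<Sum>j<n. e j * z j t) = (\<Sum>j<n. (c j - s * d j) * z j t)"
      by (rule sum.cong) (auto simp: e_def)
    then show "f t - (\<Sum>j<Suc n. e j * z j t) = r t - s * u t"
      by (simp add: e_def r_def u_def left_diff_distrib sum_subtractf sum_distrib_left algebra_simps)
  qed
  moreover have lt: "ip (\<lambda>t. r t - s * u t) (z k) = 0" if "k < n" for k
    using c[OF that] d[OF that] that unfolding r_def[symmetric] u_def[symmetric] by simp
  moreover have "ip (\<lambda>t. r t - s * u t) (z n) = 0"
  proof -
    have zn: "z n = (\<lambda>t. u t + (\<Sum>j<n. d j * z j t))" by (simp add: u_def)
    have "ip r u = s * ip u u"
    proof (cases "ip u u = 0")
      case True
      then have "L2norm u = 0" using L2norm_power2[of u] by simp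
      then have "ip r u = 0" using L2_Cauchy_Schwarz[of r u] by simp
      then show ?thesis using True by simp
    qed (simp add: s_def)
    then have "ip (\<lambda>t. r t - s * u t) u = 0" by simp
    moreover have "ip (\<lambda>t. r t - s * u t) (\<lambda>t. \<Sum>j<n. d j * z j t) = (\<Sum>j<n. d j * ip (\<lambda>t. r t - s * u t) (z j))"
      by (subst ip_sum_right) (auto simp del: ip_diff_left)
    ultimately show ?thesis using lt
      by (subst zn, subst ip_add_right) (auto simp del: ip_diff_left)
  qed
  ultimately show ?case by (auto simp: less_Suc_eq intro!: exI[of _ e] simp del: sum.lessThan_Suc)
qed simp

section \<open>Density of step functions\<close>

definition L2_subspace :: "(real \<Rightarrow> real) set \<Rightarrow> bool" where
  "L2_subspace W \<longleftrightarrow> W \<subseteq> L2 \<and> (\<lambda>t. 0) \<in> W \<and> (\<forall>f\<in>W. \<forall>g\<in>W. (\<lambda>t. f t + g t) \<in> W) \<and>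
    (\<forall>c. \<forall>f\<in>W. (\<lambda>t. c * f t) \<in> W)"

definition L2_closure :: "(real \<Rightarrow> real) set \<Rightarrow> (real \<Rightarrow> real) set" where
  "L2_closure W = {f\<in>L2. \<forall>e>0. \<exists>w\<in>W. L2norm (\<lambda>t. f t - w t) < e}"

lemma L2_closure_subset: "f \<in> L2_closure W \<Longrightarrow> f \<in> L2"
  by (simp add: L2_closure_def)

lemma L2_closure_limit:
  assumes W: "L2_subspace W" and s: "\<And>i. s i \<in> L2_closure W" and f: "f \<in> L2"
    and lim: "(\<lambda>i. L2norm (\<lambda>x. f x - s i x)) \<longlonglongrightarrow> 0"
  shows "f \<in> L2_closure W"
  unfolding L2_closure_def
proof (intro CollectI conjI allI impI f)
  fix e :: real assume "e > 0"
  then have "eventually (\<lambda>i. L2norm (\<lambda>x. f x - s i x) < e / 2) sequentially"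
    by (intro order_tendstoD(2)[OF lim]) simp
  then obtain i where i: "L2norm (\<lambda>x. f x - s i x) < e / 2"
    by (auto simp: eventually_sequentially)
  obtain w where w: "w \<in> W" "L2norm (\<lambda>x. s i x - w x) < e / 2"
    using s[of i] \<open>e > 0\<close> unfolding L2_closure_def by (auto dest: spec[of _ "e / 2"])
  have "L2norm (\<lambda>x. f x - w x) \<le> L2norm (\<lambda>x. f x - s i x) + L2norm (\<lambda>x. s i x - w x)"
    using W w f L2_closure_subset[OF s] by (intro L2norm_triangle_diff) (auto simp: L2_subspace_def)
  with i w show "\<exists>w\<in>W. L2norm (\<lambda>t. f t - w t) < e" by (intro bexI[of _ w]) auto
qed

lemma L2_closure_subspace:
  assumes W: "L2_subspace W"
  shows "L2_subspace (L2_closure W)"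
  unfolding L2_subspace_def
proof (intro conjI ballI allI)
  show "L2_closure W \<subseteq> L2" by (auto simp: L2_closure_def)
  show "(\<lambda>t. 0) \<in> L2_closure W"
    using W by (auto simp: L2_closure_def L2_subspace_def intro!: bexI[of _ "\<lambda>t. 0"])
next
  fix f g assume f: "f \<in> L2_closure W" and g: "g \<in> L2_closure W"
  show "(\<lambda>t. f t + g t) \<in> L2_closure W"
    unfolding L2_closure_def
  proof (intro CollectI conjI allI impI)
    show "(\<lambda>t. f t + g t) \<in> L2" using f g by (simp add: L2_closure_subset)
    fix e :: real assume "e > 0"
    then have "e / 2 > 0" by simp
    from f this obtain u where u: "u \<in> W" "L2norm (\<lambda>x. f x - u x) < e / 2"
      unfolding L2_closure_def by blast
    from g \<open>e / 2 > 0\<close> obtain v where v: "v \<in> W" "L2norm (\<lambda>x. g x - v x) < e / 2"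
      unfolding L2_closure_def by blast
    have "L2norm (\<lambda>x. (f x - u x) + (g x - v x)) \<le> L2norm (\<lambda>x. f x - u x) + L2norm (\<lambda>x. g x - v x)"
      using W u v f g by (intro L2norm_triangle L2_diff) (auto simp: L2_subspace_def L2_closure_subset)
    moreover have "(\<lambda>x. (f x - u x) + (g x - v x)) = (\<lambda>x. f x + g x - (u x + v x))"
      by auto
    ultimately show "\<exists>w\<in>W. L2norm (\<lambda>t. f t + g t - w t) < e"
      using W u v by (intro bexI[of _ "\<lambda>x. u x + v x"]) (auto simp: L2_subspace_def)
  qed
next
  fix c f assume f: "f \<in> L2_closure W"
  show "(\<lambda>t. c * f t) \<in> L2_closure W"
    unfolding L2_closure_def
  proof (intro CollectI conjI allI impI)
    show "(\<lambda>t. c * f t) \<in> L2" using f by (simp add: L2_closure_subset)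
    fix e :: real assume "e > 0"
    then have "e / (\<bar>c\<bar> + 1) > 0" by simp
    then obtain u where u: "u \<in> W" "L2norm (\<lambda>x. f x - u x) < e / (\<bar>c\<bar> + 1)"
      using f unfolding L2_closure_def by blast
    have "L2norm (\<lambda>x. c * f x - c * u x) = \<bar>c\<bar> * L2norm (\<lambda>x. f x - u x)"
      using L2norm_cmult[of c "\<lambda>x. f x - u x"] by (simp add: right_diff_distrib)
    also have "\<dots> \<le> (\<bar>c\<bar> + 1) * L2norm (\<lambda>x. f x - u x)" by (intro mult_right_mono) auto
    also have "\<dots> < e" using u by (simp add: pos_less_divide_eq mult.commute add_nonneg_pos)
    finally show "\<exists>w\<in>W. L2norm (\<lambda>t. c * f t - w t) < e"
      using W u by (intro bexI[of _ "\<lambda>x. c * u x"]) (auto simp: L2_subspace_def)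
  qed
qed

lemma L2_subspace_zero: "L2_subspace W \<Longrightarrow> (\<lambda>t. 0) \<in> W"
  and L2_subspace_add: "L2_subspace W \<Longrightarrow> f \<in> W \<Longrightarrow> g \<in> W \<Longrightarrow> (\<lambda>t. f t + g t) \<in> W"
  and L2_subspace_cmult: "L2_subspace W \<Longrightarrow> f \<in> W \<Longrightarrow> (\<lambda>t. c * f t) \<in> W"
  by (simp_all add: L2_subspace_def)

lemma L2_subspace_sum:
  assumes "L2_subspace W" "\<And>i. i \<in> I \<Longrightarrow> f i \<in> W"
  shows "(\<lambda>t. \<Sum>i\<in>I. f i t) \<in> W"
  using assms(2)
  by (induction I rule: infinite_finite_induct)
    (simp_all add: L2_subspace_zero[OF assms(1)] L2_subspace_add[OF assms(1)])

lemma L2_subspace_diff: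
  assumes "L2_subspace W" "f \<in> W" "g \<in> W"
  shows "(\<lambda>t. f t - g t) \<in> W"
proof -
  have "(\<lambda>t. f t + (- 1) * g t) \<in> W" using assms by (intro L2_subspace_add L2_subspace_cmult)
  then show ?thesis by simp
qed

text \<open>The interval is approximated from outside by rational ones. Its endpoints then lie in
  every approximating interval, so convergence holds at every point, as
  \<open>L2_dominated_convergence\<close> requires.\<close>

lemma indicator_Icc_in_L2_closure:
  assumes W: "L2_subspace W"
    and rat: "\<And>p q. p \<in> \<rat> \<Longrightarrow> q \<in> \<rat> \<Longrightarrow> indicator {p..q} \<in> L2_closure W"
  shows "indicator {a..b} \<in> L2_closure W"
proof -
  have "\<exists>p\<in>\<rat>. a - 1 / real (Suc n) < p \<and> p < a" for n by (rule Rats_dense_in_real) simp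
  then obtain p where p: "\<And>n. p n \<in> \<rat>" "\<And>n. a - 1 / real (Suc n) < p n" "\<And>n. p n < a" by metis
  have "\<exists>q\<in>\<rat>. b < q \<and> q < b + 1 / real (Suc n)" for n by (rule Rats_dense_in_real) simp
  then obtain q where q: "\<And>n. q n \<in> \<rat>" "\<And>n. q n < b + 1 / real (Suc n)" "\<And>n. b < q n" by metis
  have inv: "(\<lambda>n. 1 / real (Suc n)) \<longlonglongrightarrow> 0" using LIMSEQ_inverse_real_of_nat by (simp add: inverse_eq_divide)
  have lim: "(\<lambda>n. indicator {p n..q n} x :: real) \<longlonglongrightarrow> indicator {a..b} x" for x
  proof (rule tendsto_eventually)
    consider "x < a" | "x > b" | "x \<in> {a..b}" by force
    then show "eventually (\<lambda>n. (indicator {p n..q n} x :: real) = indicator {a..b} x) sequentially"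
    proof cases
      case 1
      then have "eventually (\<lambda>n. 1 / real (Suc n) < a - x) sequentially"
        by (intro order_tendstoD(2)[OF inv]) simp
      then show ?thesis
      proof eventually_elim
        case (elim n)
        then have "x < p n" using p(2)[of n] by linarith
        then show ?case using 1 by simp
      qed
    next
      case 2
      then have "eventually (\<lambda>n. 1 / real (Suc n) < x - b) sequentially"
        by (intro order_tendstoD(2)[OF inv]) simp
      then show ?thesis
      proof eventually_elim
        case (elim n)
        then have "q n < x" using q(2)[of n] by linarith
        then show ?case using 2 by simp
      qed
    next
      case 3
      have "x \<in> {p n..q n}" for n using 3 p(3)[of n] q(3)[of n] by auto
      then show ?thesis using 3 by simp
    qed
  qed
  have "indicator {p n..q n} x \<le> (indicator {a - 1..b + 1} x :: real)" for n x
  proof -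
    have "1 / real (Suc n) \<le> 1" by simp
    then have "a - 1 \<le> p n" "q n \<le> b + 1" using p(2)[of n] q(2)[of n] by linarith+
    then show ?thesis by (auto simp: indicator_def)
  qed
  then have dom: "\<bar>indicator {p n..q n} x\<bar> \<le> (indicator {a - 1..b + 1} x :: real)" for n x
    by simp
  show ?thesis
    by (rule L2_closure_limit[OF W rat[OF p(1) q(1)] _ L2_dominated_convergence(2)[OF _ _ _ dom lim]]) auto
qed

text \<open>Induction over the Borel sets. Intersecting with a fixed bounded interval keeps
  complements and unions of finite measure and supplies a common majorant in
  \<open>L2\<close>.\<close>

lemma indicator_borel_in_L2_closure:
  fixes A :: "real set" and k :: nat
  assumes W: "L2_subspace W"
    and rat: "\<And>p q. p \<in> \<rat> \<Longrightarrow> q \<in> \<rat> \<Longrightarrow> indicator {p..q} \<in> L2_closure W"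
    and "A \<in> sets borel"
  shows "indicator (A \<inter> {- real k..real k}) \<in> L2_closure W"
  using assms(3)
proof (induction rule: borel_set_induct)
  case empty
  then show ?case using L2_closure_subspace[OF W] by (simp add: L2_subspace_def indicator_def[abs_def])
next
  case (interval a b)
  then show ?case using indicator_Icc_in_L2_closure[OF W rat] by (simp only: Int_atLeastAtMost)
next
  case (compl A)
  have eq: "indicator (- A \<inter> {- real k..real k})
    = (\<lambda>x. indicator {- real k..real k} x - indicator (A \<inter> {- real k..real k}) x :: real)"
    by (auto simp: indicator_def)
  show ?case unfolding eq
    by (rule L2_subspace_diff[OF L2_closure_subspace[OF W] indicator_Icc_in_L2_closure[OF W rat] compl(2)])
next
  case (union f)
  let ?K = "{- real k..real k}"
  have [measurable]: "f i \<in> sets borel" for i by (rule union)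
  define s where "s n x = (\<Sum>i<n. indicator (f i \<inter> ?K) x :: real)" for n x
  have s: "s n x = indicator ((\<Union>i<n. f i) \<inter> ?K) x" for n x
  proof -
    have "disjoint_family_on (\<lambda>i. f i \<inter> ?K) {..<n}"
      using union(1) by (auto simp: disjoint_family_on_def)
    then have "indicator (\<Union>i<n. f i \<inter> ?K) x = s n x"
      unfolding s_def by (intro indicator_UN_disjoint) auto
    moreover have "(\<Union>i<n. f i \<inter> ?K) = (\<Union>i<n. f i) \<inter> ?K" by auto
    ultimately show ?thesis by simp
  qed
  have lim: "(\<lambda>n. s n x) \<longlonglongrightarrow> indicator ((\<Union>i. f i) \<inter> ?K) x" for x
  proof (rule tendsto_eventually)
    show "eventually (\<lambda>n. s n x = indicator ((\<Union>i. f i) \<inter> ?K) x) sequentially"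
    proof (cases "x \<in> (\<Union>i. f i)")
      case True
      then obtain i where "x \<in> f i" by auto
      then show ?thesis
        by (intro eventually_sequentiallyI[of "Suc i"]) (auto simp: s indicator_def Suc_le_eq)
    qed (auto simp: s indicator_def)
  qed
  have dom: "\<bar>s n x\<bar> \<le> indicator ?K x" for n x
    by (auto simp: s indicator_def)
  have "s n \<in> L2_closure W" for n
    unfolding s_def using union(3) by (intro L2_subspace_sum[OF L2_closure_subspace[OF W]])
  moreover from this have [measurable]: "s n \<in> borel_measurable borel" for n
    using L2_measurable[OF L2_closure_subset] by simp
  ultimately show ?case
    by (intro L2_closure_limit[OF W _ L2_dominated_convergence[OF _ _ _ dom lim]]) auto
qed

lemma L2_closure_eq_L2:
  assumes W: "L2_subspace W"
    and rat: "\<And>p q. p \<in> \<rat> \<Longrightarrow> q \<in> \<rat> \<Longrightarrow> indicator {p..q} \<in> L2_closure W"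
    and f: "f \<in> L2"
  shows "f \<in> L2_closure W"
proof -
  note [measurable] = L2_measurable[OF f]
  obtain F where F: "\<And>i. simple_function lborel (F i)" "\<And>x. (\<lambda>i. F i x) \<longlonglongrightarrow> f x"
    "\<And>i x. dist (F i x) 0 \<le> 2 * dist (f x) 0"
    using borel_measurable_implies_sequence_metric[OF L2_measurable[OF f], of 0] by auto
  \<comment> \<open>Cutting off at \<open>n\<close> makes all level sets bounded, including that of
    the value 0, so the result on bounded Borel sets applies to each of them.\<close>
  define s where "s n x = indicator {- real n..real n} x * F n x" for n x
  note [measurable] = borel_measurable_simple_function[OF F(1)]
  have "s n \<in> L2_closure W" for n
  proof -
    have "s n = (\<lambda>x. \<Sum>y\<in>range (F n). y * indicator (F n -` {y} \<inter> {- real n..real n}) x)"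
    proof
      fix x
      have "F n x = (\<Sum>y\<in>range (F n). indicator (F n -` {y}) x *\<^sub>R y)"
        by (rule simple_function_indicator_representation_banach[OF F(1), unfolded space_lborel space_borel Int_UNIV_right, OF UNIV_I])
      then have "s n x = indicator {- real n..real n} x * (\<Sum>y\<in>range (F n). indicator (F n -` {y}) x *\<^sub>R y)"
        unfolding s_def by (rule arg_cong)
      also have "\<dots> = (\<Sum>y\<in>range (F n). y * indicator (F n -` {y} \<inter> {- real n..real n}) x)"
        unfolding sum_distrib_left by (rule sum.cong) (simp_all add: indicator_inter_arith)
      finally show "s n x = (\<Sum>y\<in>range (F n). y * indicator (F n -` {y} \<inter> {- real n..real n}) x)" .
    qed
    moreover have "indicator (F n -` {y} \<inter> {- real n..real n}) \<in> L2_closure W" for y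
      using simple_functionD(2)[OF F(1), of n "{y}"] by (intro indicator_borel_in_L2_closure[OF W rat]) auto
    then have "(\<lambda>x. y * indicator (F n -` {y} \<inter> {- real n..real n}) x) \<in> L2_closure W" for y
      by (rule L2_subspace_cmult[OF L2_closure_subspace[OF W]])
    ultimately show ?thesis
      using L2_subspace_sum[OF L2_closure_subspace[OF W],
          of "range (F n)" "\<lambda>y x. y * indicator (F n -` {y} \<inter> {- real n..real n}) x"] by simp
  qed
  moreover have lim: "(\<lambda>n. s n x) \<longlonglongrightarrow> f x" for x
  proof (rule Lim_transform_eventually[OF F(2)])
    obtain n where "\<bar>x\<bar> \<le> real n" using real_arch_simple by blast
    then show "eventually (\<lambda>n. F n x = s n x) sequentially"
      by (intro eventually_sequentiallyI[of n]) (auto simp: s_def indicator_def)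
  qed
  moreover have "\<bar>s n x\<bar> \<le> 2 * \<bar>f x\<bar>" for n x
    using F(3)[of n x] by (auto simp: s_def indicator_def)
  then have "(\<lambda>i. L2norm (\<lambda>x. f x - s i x)) \<longlonglongrightarrow> 0"
    by (intro L2_dominated_convergence(2)[where w="\<lambda>x. 2 * \<bar>f x\<bar>"] lim L2_cmult L2_abs f)
      (auto simp: s_def[abs_def])
  ultimately show ?thesis by (intro L2_closure_limit[OF W _ f])
qed

section \<open>Adding a block of non-negative functions\<close>

text \<open>Open unit intervals, so that distinct cells are disjoint and, for
  \<open>T \<ge> 0\<close>, all of them vanish on the whole of \<open>[-T, T]\<close>, endpoints
  included.\<close>

definition cell :: "real \<Rightarrow> nat \<Rightarrow> real \<Rightarrow> real" where
  "cell T i = indicator {T + real i<..<T + real i + 1}"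

lemma cell_L2 [simp]: "cell T i \<in> L2"
  unfolding cell_def by (rule L2_indicator) auto

lemma cell_nonneg [simp]: "0 \<le> cell T i t"
  by (simp add: cell_def)

lemma ip_cell: "ip (cell T i) (cell T k) = (if i = k then 1 else 0)"
proof (cases "i = k")
  case True
  have "(\<lambda>x. cell T i x * cell T i x) = indicator {T + real i<..<T + real i + 1}"
    by (auto simp: cell_def indicator_def)
  then show ?thesis using True by (simp add: ip_def)
next
  case False
  have "cell T i x = 0 \<or> cell T k x = 0" for x
  proof (rule ccontr)
    assume "\<not> ?thesis"
    then have "T + real i < x" "x < T + real i + 1" "T + real k < x" "x < T + real k + 1"
      by (auto simp: cell_def indicator_def split: if_splits)
    then have "real i < real k + 1" "real k < real i + 1" by linarith+
    then show False using False by linarith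
  qed
  then show ?thesis using False by (simp add: ip_disjoint_support)
qed

lemma cell_inside: "0 \<le> T \<Longrightarrow> \<bar>t\<bar> \<le> T \<Longrightarrow> cell T i t = 0"
  by (auto simp: cell_def indicator_def)

lemma cell_outside: "i < L \<Longrightarrow> 0 \<le> T \<Longrightarrow> T + real L < \<bar>t\<bar> \<Longrightarrow> cell T i t = 0"
  by (auto simp: cell_def indicator_def)

text \<open>The cells are orthonormal and disjoint from the support of \<open>g\<close>, so
  Pythagoras reduces norms to sums of squared coefficients.\<close>

lemma L2norm_add_cells:
  assumes g: "g \<in> L2" and "0 \<le> T" and supp: "\<And>t. T < \<bar>t\<bar> \<Longrightarrow> g t = 0"
  shows "(L2norm (\<lambda>t. g t + (\<Sum>i<L. c i * cell T i t)))\<^sup>2 = (L2norm g)\<^sup>2 + (\<Sum>i<L. (c i)\<^sup>2)"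
proof -
  have "ip g (\<lambda>t. \<Sum>i<L. c i * cell T i t) = 0"
  proof (rule ip_disjoint_support)
    show "g x = 0 \<or> (\<Sum>i<L. c i * cell T i x) = 0" for x
      using supp[of x] cell_inside[OF \<open>0 \<le> T\<close>, of x] by (cases "T < \<bar>x\<bar>") auto
  qed
  moreover have "(L2norm (\<lambda>t. \<Sum>i<L. c i * cell T i t))\<^sup>2 = (\<Sum>i<L. (c i)\<^sup>2)"
    unfolding L2norm_power2 by (simp add: ip_cell if_distrib cong: if_cong) (simp add: power2_eq_square)
  ultimately show ?thesis using g by (subst L2norm_pythagoras) auto
qed

text \<open>The square expands this way because the normalised alternating vector has norm 1. With
  \<open>y = x\<close> its component is removed; \<open>y = 1\<close> gives the distance of
  \<open>A\<close> from that vector.\<close>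

lemma sum_remove_alternating:
  fixes x :: real
  assumes "L > 0" "(\<Sum>i<L. A i * ((-1) ^ i / sqrt (real L))) = x"
  shows "(\<Sum>i<L. (A i - y * ((-1) ^ i / sqrt (real L)))\<^sup>2) = (\<Sum>i<L. (A i)\<^sup>2) - 2 * y * x + y\<^sup>2"
proof -
  have "(A i - y * ((-1) ^ i / sqrt (real L)))\<^sup>2
    = (A i)\<^sup>2 - 2 * y * (A i * ((-1) ^ i / sqrt (real L))) + y\<^sup>2 / real L" for i
    by (simp add: power2_diff power_mult_distrib power_divide algebra_simps flip: power_mult)
  then have "(\<Sum>i<L. (A i - y * ((-1) ^ i / sqrt (real L)))\<^sup>2)
    = (\<Sum>i<L. (A i)\<^sup>2) - 2 * y * (\<Sum>i<L. A i * ((-1) ^ i / sqrt (real L))) + real L * (y\<^sup>2 / real L)"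
    by (simp add: sum.distrib sum_subtractf sum_distrib_left)
  then show ?thesis using assms by simp
qed

lemma abs_sum_le_sqrt_L2_set: "\<bar>\<Sum>i<L. A i\<bar> \<le> sqrt (real L) * L2_set A {..<L}"
proof -
  have "(\<Sum>i<L. A i) \<^sup>2 \<le> real L * (\<Sum>i<L. (A i)\<^sup>2)"
    using sum_squared_le_sum_of_squares[of A "{..<L}"] by (simp add: mult.commute)
  then have "\<bar>\<Sum>i<L. A i\<bar> \<le> sqrt (real L * (\<Sum>i<L. (A i)\<^sup>2))"
    by (rule real_le_rsqrt[of "\<bar>\<Sum>i<L. A i\<bar>", simplified])
  then show ?thesis by (simp add: L2_set_def real_sqrt_mult)
qed

text \<open>Replacing the unit vector \<open>\<rho> = (\<Sum>i<L. (-1) ^ i / sqrt L * cell T i)\<close> by \<open>r\<close> is isometric on the span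
  of the cells and \<open>r\<close>. It turns the rows into sign changing vectors, and adding
  \<open>\<kappa> * (\<bar>r\<bar> + \<bar>\<rho>\<bar>)\<close> to each of them makes them non-negative. This is a small perturbation, since
  \<open>\<kappa>\<close> is the absolute value of the inner product of a row with \<open>\<rho>\<close>. Since \<open>\<rho>\<close> is almost in the span of
  the rows, \<open>r\<close> is almost in the span of the result.\<close>
lemma nonneg_block_exists:
  fixes r :: "real \<Rightarrow> real" and q e T :: real
  assumes r: "r \<in> L2" "L2norm r = 1" and T: "0 \<le> T" "\<And>t. T < \<bar>t\<bar> \<Longrightarrow> r t = 0"
    and "1 < q" "0 < e"
  obtains n :: nat and y :: "nat \<Rightarrow> real \<Rightarrow> real" and T' :: real and b :: "nat \<Rightarrow> real"
  where "n > 0" "\<And>j. y j \<in> L2" "\<And>j t. 0 \<le> y j t" "\<And>j. j < n \<Longrightarrow> 0 < L2norm (y j)"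
    "\<And>j t. T' < \<bar>t\<bar> \<Longrightarrow> y j t = 0"
    "\<And>a m v. m \<le> n \<Longrightarrow> v \<in> L2 \<Longrightarrow> ip v r = 0 \<Longrightarrow> \<forall>t. T < \<bar>t\<bar> \<longrightarrow> v t = 0 \<Longrightarrow>
      L2norm (\<lambda>t. v t + (\<Sum>j<m. a j * y j t)) \<le> q * L2norm (\<lambda>t. v t + (\<Sum>j<n. a j * y j t))"
    "L2norm (\<lambda>t. r t - (\<Sum>j<n. b j * y j t)) \<le> e"
proof -
  \<comment> \<open>Chosen for the inequality \<open>\<delta>q\<close> below. The cap
    \<open>1 / 4\<close> bounds \<open>2 * \<delta>\<^sup>2\<close> by \<open>\<delta>\<close> and
    keeps \<open>1 - 2 * \<delta>\<close> positive.\<close>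
  define \<delta> where "\<delta> = min (1 / 4) ((q - 1) / (4 + 2 * q))"
  have "\<delta> \<le> (q - 1) / (4 + 2 * q)" by (simp add: \<delta>_def)
  then have "\<delta> * (4 + 2 * q) \<le> q - 1" using \<open>1 < q\<close> by (subst (asm) pos_le_divide_eq) auto
  moreover have "0 < \<delta>" using \<open>1 < q\<close> by (simp add: \<delta>_def)
  moreover have "\<delta> \<le> 1 / 4" unfolding \<delta>_def by (rule min.cobounded1)
  ultimately have \<delta>: "0 < \<delta>" "\<delta> \<le> 1 / 4" "\<delta> * (4 + 2 * q) \<le> q - 1" by auto
  have \<delta>q: "(1 + 2 * \<delta>) * (1 + \<delta>) \<le> q * (1 - 2 * \<delta>)"
  proof -
    have "\<delta> * (\<delta> * 2) \<le> \<delta> * 1" using \<delta> by (intro mult_left_mono) auto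
    moreover have "1 + (\<delta> * 4 + \<delta> * (q * 2)) \<le> q" using \<delta>(3) by (simp add: algebra_simps)
    ultimately have "1 + (\<delta> * 3 + (\<delta> * (\<delta> * 2) + \<delta> * (q * 2))) \<le> q" by linarith
    then show ?thesis by (simp add: algebra_simps)
  qed
  have "\<delta> < 1" using \<delta> by simp
  obtain n L Z b where n: "n > 0" "L > 0" and Z0: "\<And>j i. Z j i \<ge> 0"
    and Zsum: "\<And>j. j < n \<Longrightarrow> (\<Sum>i<L. Z j i) = 2 - \<delta>"
    and Zalt: "\<And>j. j < n \<Longrightarrow> (\<Sum>i<L. (-1) ^ i * Z j i) = (-1) ^ j * \<delta>"
    and Zbasic: "\<And>a m. m \<le> n \<Longrightarrow> L2_set (\<lambda>i. \<Sum>j<m. a j * Z j i) {..<L} \<le> (1 + \<delta>) * L2_set (\<lambda>i. \<Sum>j<n. a j * Z j i) {..<L}"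
    and b0: "(\<Sum>j<n. b j) = 0"
    and b: "L2_set (\<lambda>i. (\<Sum>j<n. b j * Z j i) - (-1) ^ i / sqrt (real L)) {..<L} \<le> e"
    using nonneg_rows_with_small_alternating_sum[OF \<delta>(1) \<open>\<delta> < 1\<close> \<delta>(1) \<open>0 < e\<close>] by blast
  define w where "w = 1 / sqrt (real L)"
  define \<kappa> where "\<kappa> = \<delta> * w"
  have w: "w > 0" "w\<^sup>2 = 1 / real L" "\<And>i. (-1) ^ i / sqrt (real L) = (-1) ^ i * w"
    using n by (auto simp: w_def power_divide)
  have "\<kappa> > 0" using \<delta> w by (simp add: \<kappa>_def)
  \<comment> \<open>Row \<open>j\<close> has component \<open>(-1) ^ j * \<kappa>\<close> along
    \<open>\<rho>\<close>. It is replaced by the same multiple of \<open>r\<close>, then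
    \<open>\<kappa> * (\<bar>r\<bar> + \<bar>\<rho>\<bar>)\<close> is added. Collected cell by cell,
    every bracket is non-negative.\<close>
  define y where "y j t = (\<Sum>i<L. (Z j i + \<kappa> * w * (1 - (-1) ^ (i + j))) * cell T i t)
    + \<kappa> * (\<bar>r t\<bar> + (-1) ^ j * r t)" for j t
  define A where "A a m i = (\<Sum>j<m. a j * Z j i)" for a m i
  define S where "S a m = (\<Sum>j<m. a j)" for a :: "nat \<Rightarrow> real" and m :: nat
  define D where "D a m = (\<Sum>j<m. (-1) ^ j * a j)" for a :: "nat \<Rightarrow> real" and m :: nat
  \<comment> \<open>\<open>U\<close> is the combination \<open>A\<close> of the rows after
    \<open>\<rho>\<close> has been replaced by \<open>r\<close>, with \<open>\<kappa> * D\<close>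
    its component along \<open>\<rho>\<close>. \<open>E\<close> is the common correction
    \<open>\<bar>r\<bar> + \<bar>\<rho>\<bar>\<close>; it enters only through the coefficient sum
    \<open>S\<close>.\<close>
  define U where "U a m t = \<kappa> * D a m * r t + (\<Sum>i<L. (A a m i - \<kappa> * D a m * ((-1) ^ i / sqrt (real L))) * cell T i t)" for a m t
  define E where "E t = \<bar>r t\<bar> + (\<Sum>i<L. w * cell T i t)" for t
  have decomp: "(\<Sum>j<m. a j * y j t) = U a m t + \<kappa> * S a m * E t" for a m t
  proof (induction m)
    case 0
    show ?case by (simp add: U_def A_def S_def D_def)
  next
    case (Suc m)
    have "a m * y m t = (U a (Suc m) t - U a m t) + \<kappa> * a m * E t"
      unfolding y_def U_def E_def w(3)
      by (simp add: A_def D_def sum_distrib_left sum_distrib_right sum_subtractf sum.distrib algebra_simps power_add)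
    then show ?case using Suc by (simp add: S_def algebra_simps)
  qed
  have U_L2 [simp]: "U a m \<in> L2" for a m
    unfolding U_def[abs_def] by (intro L2_add L2_sum L2_cmult r cell_L2)
  have E_L2 [simp]: "E \<in> L2"
    unfolding E_def[abs_def] by (intro L2_add L2_sum L2_cmult L2_abs r cell_L2)
  have y_L2 [simp]: "y j \<in> L2" for j
    unfolding y_def[abs_def] by (intro L2_add L2_sum L2_cmult L2_abs r cell_L2)
  have ZD: "(\<Sum>i<L. A a m i * ((-1) ^ i / sqrt (real L))) = \<kappa> * D a m" if "m \<le> n" for a m
  proof -
    have "(\<Sum>i<L. A a m i * ((-1) ^ i / sqrt (real L))) = (\<Sum>i<L. \<Sum>j<m. w * (a j * ((-1) ^ i * Z j i)))"
      unfolding w(3) A_def sum_distrib_right by (intro sum.cong refl) simp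
    also have "\<dots> = (\<Sum>j<m. w * (a j * (\<Sum>i<L. (-1) ^ i * Z j i)))"
      by (subst sum.swap) (simp add: sum_distrib_left)
    also have "\<dots> = (\<Sum>j<m. \<kappa> * ((-1) ^ j * a j))"
      using that by (intro sum.cong refl) (simp add: Zalt \<kappa>_def)
    finally show ?thesis by (simp add: D_def sum_distrib_left)
  qed
  have ip_rr: "ip r r = 1" using L2norm_power2[of r] r by simp
  \<comment> \<open>This is the isometry: removing the component \<open>?x\<close> along
    \<open>\<rho>\<close> lowers the square sum by \<open>?x\<^sup>2\<close>, and
    \<open>?x * r\<close> restores that amount, orthogonally to \<open>v\<close>.\<close>
  have normU: "(L2norm (\<lambda>t. v t + U a m t))\<^sup>2 = (L2norm v)\<^sup>2 + (L2_set (A a m) {..<L})\<^sup>2"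
    if "m \<le> n" "v \<in> L2" "ip v r = 0" "\<And>t. T < \<bar>t\<bar> \<Longrightarrow> v t = 0" for a m v
  proof -
    let ?x = "\<kappa> * D a m"
    have "(L2norm (\<lambda>t. v t + U a m t))\<^sup>2
      = (L2norm (\<lambda>t. v t + ?x * r t))\<^sup>2 + (\<Sum>i<L. (A a m i - ?x * ((-1) ^ i / sqrt (real L)))\<^sup>2)"
      unfolding U_def add.assoc[symmetric] using that r T by (intro L2norm_add_cells) auto
    also have "(L2norm (\<lambda>t. v t + ?x * r t))\<^sup>2 = (L2norm v)\<^sup>2 + ?x\<^sup>2"
      using that r by (subst L2norm_pythagoras) (auto simp: L2norm_cmult power_mult_distrib)
    also have "(\<Sum>i<L. (A a m i - ?x * ((-1) ^ i / sqrt (real L)))\<^sup>2) = (\<Sum>i<L. (A a m i)\<^sup>2) - 2 * ?x * ?x + ?x\<^sup>2"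
      by (rule sum_remove_alternating[OF n(2) ZD[OF that(1)]])
    finally show ?thesis by (simp add: L2_set_def sum_nonneg power2_eq_square)
  qed
  have normE: "L2norm E \<le> 2"
  proof (rule power2_le_imp_le)
    have "(L2norm E)\<^sup>2 = (L2norm (\<lambda>t. \<bar>r t\<bar>))\<^sup>2 + (\<Sum>i<L. w\<^sup>2)"
      unfolding E_def using r T by (intro L2norm_add_cells) auto
    also have "(L2norm (\<lambda>t. \<bar>r t\<bar>))\<^sup>2 = 1" using r by (simp add: L2norm_def)
    finally show "(L2norm E)\<^sup>2 \<le> 2\<^sup>2" using n by (simp add: w(2))
  qed simp
  \<comment> \<open>Every row sums to \<open>2 - \<delta> \<ge> 1\<close>, so the sum of the
    coefficients is controlled by the sum of the entries of \<open>A\<close>.\<close>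
  have SA: "\<bar>S a m\<bar> \<le> sqrt (real L) * L2_set (A a m) {..<L}" if "m \<le> n" for a m
  proof -
    have "(\<Sum>i<L. A a m i) = (\<Sum>j<m. a j * (\<Sum>i<L. Z j i))"
      unfolding A_def by (subst sum.swap) (simp add: sum_distrib_left)
    also have "\<dots> = (2 - \<delta>) * S a m"
      using that by (simp add: Zsum S_def sum_distrib_right mult.commute)
    finally have "(2 - \<delta>) * \<bar>S a m\<bar> \<le> sqrt (real L) * L2_set (A a m) {..<L}"
      using abs_sum_le_sqrt_L2_set[of "A a m" L] \<delta> by (simp add: abs_mult)
    moreover have "1 * \<bar>S a m\<bar> \<le> (2 - \<delta>) * \<bar>S a m\<bar>" using \<delta> by (intro mult_right_mono) auto
    ultimately show ?thesis by simp
  qed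
  \<comment> \<open>The factor \<open>sqrt L\<close> from \<open>SA\<close> cancels against
    \<open>\<kappa> = \<delta> / sqrt L\<close>, so the correction is small relative to
    \<open>A\<close> whatever the size of the block.\<close>
  have pert: "L2norm (\<lambda>t. \<kappa> * S a m * E t) \<le> 2 * \<delta> * L2_set (A a m) {..<L}" if "m \<le> n" for a m
  proof -
    have "L2norm (\<lambda>t. \<kappa> * S a m * E t) = \<kappa> * \<bar>S a m\<bar> * L2norm E"
      using \<open>\<kappa> > 0\<close> by (simp add: L2norm_cmult abs_mult)
    also have "\<dots> \<le> \<kappa> * (sqrt (real L) * L2_set (A a m) {..<L}) * 2"
      using \<open>\<kappa> > 0\<close> SA[OF that] normE by (intro mult_mono) auto
    also have "\<dots> = 2 * \<delta> * L2_set (A a m) {..<L}" using n by (simp add: \<kappa>_def w_def)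
    finally show ?thesis .
  qed
  have basic: "L2norm (\<lambda>t. v t + (\<Sum>j<m. a j * y j t)) \<le> (1 + 2 * \<delta>) * L2norm (\<lambda>t. v t + U a m t)
      \<and> (1 - 2 * \<delta>) * L2norm (\<lambda>t. v t + U a m t) \<le> L2norm (\<lambda>t. v t + (\<Sum>j<m. a j * y j t))"
    if "m \<le> n" "v \<in> L2" "ip v r = 0" "\<And>t. T < \<bar>t\<bar> \<Longrightarrow> v t = 0" for a m v
  proof -
    have "L2_set (A a m) {..<L} \<le> L2norm (\<lambda>t. v t + U a m t)"
      by (rule power2_le_imp_le) (simp_all add: normU[OF that])
    then have "2 * \<delta> * L2_set (A a m) {..<L} \<le> 2 * \<delta> * L2norm (\<lambda>t. v t + U a m t)"
      using \<delta> by (intro mult_left_mono) auto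
    then have p: "L2norm (\<lambda>t. \<kappa> * S a m * E t) \<le> 2 * \<delta> * L2norm (\<lambda>t. v t + U a m t)"
      using pert[OF that(1), of a] by linarith
    have "L2norm (\<lambda>t. v t + (\<Sum>j<m. a j * y j t)) \<le> L2norm (\<lambda>t. v t + U a m t) + L2norm (\<lambda>t. \<kappa> * S a m * E t)"
      unfolding decomp add.assoc[symmetric] using that by (intro L2norm_triangle) auto
    moreover have "L2norm (\<lambda>t. v t + U a m t)
        \<le> L2norm (\<lambda>t. v t + (\<Sum>j<m. a j * y j t)) + L2norm (\<lambda>t. (- \<kappa> * S a m) * E t)"
    proof -
      have "(\<lambda>t. v t + U a m t) = (\<lambda>t. (v t + (\<Sum>j<m. a j * y j t)) + (- \<kappa> * S a m) * E t)"
        by (simp add: decomp)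
      moreover have "L2norm \<dots> \<le> L2norm (\<lambda>t. v t + (\<Sum>j<m. a j * y j t)) + L2norm (\<lambda>t. (- \<kappa> * S a m) * E t)"
        using that by (intro L2norm_triangle L2_add L2_sum L2_cmult) auto
      ultimately show ?thesis by simp
    qed
    moreover have "L2norm (\<lambda>t. (- \<kappa> * S a m) * E t) = L2norm (\<lambda>t. \<kappa> * S a m * E t)"
      unfolding L2norm_cmult by simp
    ultimately show ?thesis using p by (simp add: algebra_simps)
  qed
  show thesis
  proof
    show "n > 0" by fact
    show "y j \<in> L2" for j by simp
    show "0 \<le> y j t" for j t
    proof -
      have "(-1 :: real) ^ k \<le> 1" "- 1 \<le> (-1 :: real) ^ k" for k :: nat
        by (cases "even k"; simp)+
      then have alt: "0 \<le> 1 - (-1 :: real) ^ (i + j)" for i by simp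
      have "0 \<le> \<bar>r t\<bar> + (-1) ^ j * r t" by (cases "even j") auto
      then have "0 \<le> \<kappa> * (\<bar>r t\<bar> + (-1) ^ j * r t)" using \<open>\<kappa> > 0\<close> by simp
      moreover have "0 \<le> (\<Sum>i<L. (Z j i + \<kappa> * w * (1 - (-1) ^ (i + j))) * cell T i t)"
        using \<open>\<kappa> > 0\<close> w(1) Z0 alt
        by (intro sum_nonneg mult_nonneg_nonneg add_nonneg_nonneg) (auto simp: less_imp_le)
      ultimately show ?thesis by (simp add: y_def)
    qed
    show "0 < L2norm (y j)" if "j < n" for j
    proof -
      \<comment> \<open>The unit coefficient vector selects \<open>y j\<close>; its coefficient sum
        1 forces \<open>A \<noteq> 0\<close> by \<open>SA\<close>, and \<open>basic\<close> carries
        this over to \<open>y j\<close>.\<close>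
      define a where "a i = (if i = j then 1 else 0 :: real)" for i
      have eq: "(\<Sum>i<n. a i * f i) = f j" for f
      proof -
        have "(\<Sum>i<n. a i * f i) = (\<Sum>i<n. if i = j then f i else 0)"
          by (rule sum.cong) (auto simp: a_def)
        then show ?thesis using \<open>j < n\<close> by simp
      qed
      have "S a n = 1" unfolding S_def using eq[of "\<lambda>_. 1"] by simp
      then have "1 \<le> sqrt (real L) * L2_set (A a n) {..<L}" using SA[of n a] by simp
      then have "L2_set (A a n) {..<L} \<noteq> 0" by auto
      moreover have "(L2norm (\<lambda>t. 0 + U a n t))\<^sup>2 = (L2norm (\<lambda>t. 0))\<^sup>2 + (L2_set (A a n) {..<L})\<^sup>2"
        by (rule normU) (auto simp: ip_def)
      ultimately have "(L2norm (\<lambda>t. 0 + U a n t))\<^sup>2 \<noteq> 0" by simp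
      then have "L2norm (\<lambda>t. 0 + U a n t) \<noteq> 0" by auto
      then have "0 < L2norm (\<lambda>t. 0 + U a n t)" using L2norm_nonneg less_le by metis
      then have "0 < (1 - 2 * \<delta>) * L2norm (\<lambda>t. 0 + U a n t)" using \<delta> by simp
      also have "\<dots> \<le> L2norm (\<lambda>t. 0 + (\<Sum>j<n. a j * y j t))"
        using basic[of n "\<lambda>t. 0" a] by (simp add: ip_def)
      also have "\<dots> = L2norm (y j)" by (simp add: eq[of "\<lambda>j. y j _"])
      finally show ?thesis .
    qed
    show "y j t = 0" if "T + real L < \<bar>t\<bar>" for j t
      using that T n cell_outside[of _ L T t] by (simp add: y_def)
    show "L2norm (\<lambda>t. v t + (\<Sum>j<m. a j * y j t)) \<le> q * L2norm (\<lambda>t. v t + (\<Sum>j<n. a j * y j t))"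
      if m: "m \<le> n" and "v \<in> L2" "ip v r = 0" "\<forall>t. T < \<bar>t\<bar> \<longrightarrow> v t = 0" for a m v
    proof -
      have v: "v \<in> L2" "ip v r = 0" "\<And>t. T < \<bar>t\<bar> \<Longrightarrow> v t = 0" using that by auto
      let ?Um = "L2norm (\<lambda>t. v t + U a m t)" and ?Un = "L2norm (\<lambda>t. v t + U a n t)"
      have "?Um \<le> (1 + \<delta>) * ?Un"
      proof (rule power2_le_imp_le)
        have "(L2_set (A a m) {..<L})\<^sup>2 \<le> ((1 + \<delta>) * L2_set (A a n) {..<L})\<^sup>2"
          using Zbasic[OF m, of a] by (intro power_mono) (auto simp: A_def[abs_def])
        moreover have "1 * (L2norm v)\<^sup>2 \<le> (1 + \<delta>)\<^sup>2 * (L2norm v)\<^sup>2"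
          using \<delta> by (intro mult_right_mono) auto
        ultimately show "?Um\<^sup>2 \<le> ((1 + \<delta>) * ?Un)\<^sup>2"
          by (simp add: normU[OF m v] normU[OF order_refl v] power_mult_distrib distrib_left)
      qed (use \<delta> in simp)
      then have "(1 + 2 * \<delta>) * ?Um \<le> (1 + 2 * \<delta>) * ((1 + \<delta>) * ?Un)"
        using \<delta> by (intro mult_left_mono) auto
      also have "\<dots> \<le> q * (1 - 2 * \<delta>) * ?Un"
        unfolding mult.assoc[symmetric] by (intro mult_right_mono \<delta>q) simp
      also have "\<dots> \<le> q * L2norm (\<lambda>t. v t + (\<Sum>j<n. a j * y j t))"
        unfolding mult.assoc using basic[OF order_refl v, of a] \<open>1 < q\<close> by (intro mult_left_mono) auto
      finally show ?thesis using basic[OF m v, of a] by linarith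
    qed
    show "L2norm (\<lambda>t. r t - (\<Sum>j<n. b j * y j t)) \<le> e"
    proof (rule power2_le_imp_le)
      let ?x = "\<kappa> * D b n"
      \<comment> \<open>As the \<open>b j\<close> sum to 0, the correction \<open>E\<close> drops
        out and the combination equals \<open>U b n\<close>. By the isometry its distance from
        \<open>r\<close> is that of \<open>A b n\<close> from \<open>\<rho>\<close>, which
        \<open>b\<close> bounds by \<open>e\<close>.\<close>
      have "S b n = 0" using b0 by (simp add: S_def)
      then have "(\<lambda>t. r t - (\<Sum>j<n. b j * y j t))
        = (\<lambda>t. (1 - ?x) * r t + (\<Sum>i<L. (?x * ((-1) ^ i / sqrt (real L)) - A b n i) * cell T i t))"
        by (simp add: decomp U_def algebra_simps sum_subtractf)
      then have "(L2norm (\<lambda>t. r t - (\<Sum>j<n. b j * y j t)))\<^sup>2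
        = (L2norm (\<lambda>t. (1 - ?x) * r t))\<^sup>2 + (\<Sum>i<L. (?x * ((-1) ^ i / sqrt (real L)) - A b n i)\<^sup>2)"
        using r T by (simp only:) (intro L2norm_add_cells, auto)
      also have "\<dots> = (1 - ?x)\<^sup>2 + ((\<Sum>i<L. (A b n i)\<^sup>2) - 2 * ?x * ?x + ?x\<^sup>2)"
        unfolding power2_commute[of "?x * _"] sum_remove_alternating[OF n(2) ZD[OF order_refl], of b ?x]
        by (simp add: L2norm_cmult r(2))
      also have "\<dots> = (\<Sum>i<L. (A b n i)\<^sup>2) - 2 * 1 * ?x + 1\<^sup>2"
        by (simp add: power2_eq_square algebra_simps)
      also have "\<dots> = (\<Sum>i<L. (A b n i - 1 * ((-1) ^ i / sqrt (real L)))\<^sup>2)"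
        by (rule sum_remove_alternating[OF n(2) ZD[OF order_refl], symmetric])
      also have "\<dots> = (L2_set (\<lambda>i. A b n i - (-1) ^ i / sqrt (real L)) {..<L})\<^sup>2"
        by (simp add: L2_set_def sum_nonneg)
      also have "\<dots> \<le> e\<^sup>2" using b by (intro power_mono) (auto simp: A_def)
      finally show "(L2norm (\<lambda>t. r t - (\<Sum>j<n. b j * y j t)))\<^sup>2 \<le> e\<^sup>2" .
    qed (use \<open>0 < e\<close> in simp)
  qed
qed

text \<open>The induction invariant. Bounded support leaves room for the cells of the next block.
  Partial sums are compared with the full sum only; shorter sums are covered by setting coefficients
  to 0.\<close>

definition positive_system :: "real \<Rightarrow> nat \<Rightarrow> (nat \<Rightarrow> real \<Rightarrow> real) \<Rightarrow> bool" where
  "positive_system C n z \<longleftrightarrow> (\<forall>j<n. z j \<in> L2 \<and> (\<forall>t. 0 \<le> z j t) \<and> 0 < L2norm (z j)) \<and>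
    (\<exists>T\<ge>0. \<forall>j<n. \<forall>t. T < \<bar>t\<bar> \<longrightarrow> z j t = 0) \<and>
    (\<forall>a m. m \<le> n \<longrightarrow> L2norm (\<lambda>t. \<Sum>j<m. a j * z j t) \<le> C * L2norm (\<lambda>t. \<Sum>j<n. a j * z j t))"

lemma positive_system_0: "positive_system C 0 z"
  by (auto simp: positive_system_def)

lemma positive_system_cong:
  assumes "positive_system C n z" "\<And>j. j < n \<Longrightarrow> z' j = z j"
  shows "positive_system C n z'"
proof -
  have "(\<Sum>j<m. a j * z' j t) = (\<Sum>j<m. a j * z j t)" if "m \<le> n" for a m t
    using that assms(2) by (intro sum.cong) auto
  then show ?thesis using assms unfolding positive_system_def by auto
qed

lemma sum_lessThan_append:
  fixes f :: "nat \<Rightarrow> 'a::comm_monoid_add"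
  shows "(\<Sum>j<n + k. f j) = (\<Sum>j<n. f j) + (\<Sum>j<k. f (n + j))"
  by (induction k) (simp_all add: add.assoc)

text \<open>The remainder \<open>g\<close> of \<open>f\<close> modulo the old span, normalised to
  \<open>r\<close>, is orthogonal to the old functions. A block almost containing \<open>r\<close>
  therefore brings \<open>f\<close> close to the new span, and its factor \<open>C' / C\<close>
  raises the constant from \<open>C\<close> to \<open>C'\<close>.\<close>

lemma positive_system_extend:
  assumes z: "positive_system C n z" and C: "1 \<le> C" "C < C'"
    and f: "f \<in> L2" "\<And>t. S < \<bar>t\<bar> \<Longrightarrow> f t = 0" and "0 < e"
  obtains n' z' a where "n < n'" "\<And>j. j < n \<Longrightarrow> z' j = z j" "positive_system C' n' z'"
    "L2norm (\<lambda>t. f t - (\<Sum>j<n'. a j * z' j t)) \<le> e"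
proof -
  have zL2: "z j \<in> L2" and z0: "0 \<le> z j t" and zpos: "0 < L2norm (z j)" if "j < n" for j t
    using z that by (auto simp: positive_system_def)
  have zbasic: "L2norm (\<lambda>t. \<Sum>j<m. a j * z j t) \<le> C * L2norm (\<lambda>t. \<Sum>j<n. a j * z j t)" if "m \<le> n" for a m
    using z that by (auto simp: positive_system_def)
  obtain T0 where T0: "0 \<le> T0" "\<And>j t. j < n \<Longrightarrow> T0 < \<bar>t\<bar> \<Longrightarrow> z j t = 0"
    using z by (auto simp: positive_system_def)
  define T where "T = max T0 S"
  have T: "0 \<le> T" "\<And>t. T < \<bar>t\<bar> \<Longrightarrow> f t = 0" "\<And>j t. j < n \<Longrightarrow> T < \<bar>t\<bar> \<Longrightarrow> z j t = 0"
    using T0 f(2) by (auto simp: T_def)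
  have vL2: "(\<lambda>t. \<Sum>j<n. a j * z j t) \<in> L2" for a
    using zL2 by (intro L2_sum L2_cmult) simp
  obtain c where c: "\<And>k. k < n \<Longrightarrow> ip (\<lambda>t. f t - (\<Sum>j<n. c j * z j t)) (z k) = 0"
    using orthogonal_projection_exists[of n z f] zL2 f(1) by blast
  define g where "g t = f t - (\<Sum>j<n. c j * z j t)" for t
  have gL2: "g \<in> L2" unfolding g_def[abs_def] using f(1) vL2 by (rule L2_diff)
  have gz: "ip g (z k) = 0" if "k < n" for k using c[OF that] by (simp add: g_def[abs_def])
  have gT: "g t = 0" if "T < \<bar>t\<bar>" for t using that T by (simp add: g_def)
  \<comment> \<open>If \<open>g\<close> has norm 0 there is no direction to normalise; a cell beyond
    \<open>T\<close> with \<open>s = 0\<close> serves instead, so that the system still grows. The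
    bound \<open>T + 1\<close> makes room for this cell.\<close>
  have "\<exists>r s. r \<in> L2 \<and> L2norm r = 1 \<and> (\<forall>t. T + 1 < \<bar>t\<bar> \<longrightarrow> r t = 0) \<and> (\<forall>k<n. ip r (z k) = 0) \<and>
    L2norm (\<lambda>t. g t - s * r t) = 0"
  proof (cases "L2norm g = 0")
    case True
    have "ip (cell T 0) (z k) = 0" if "k < n" for k
    proof (rule ip_disjoint_support)
      show "cell T 0 x = 0 \<or> z k x = 0" for x
        using T(3)[OF that, of x] cell_inside[OF T(1), of x] by (cases "T < \<bar>x\<bar>") auto
    qed
    moreover have "L2norm (cell T 0) = 1"
      by (rule power2_eq_imp_eq) (simp_all add: L2norm_power2 ip_cell)
    moreover have "cell T 0 t = 0" if "T + 1 < \<bar>t\<bar>" for t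
      using cell_outside[of 0 1 T t] T(1) that by simp
    ultimately show ?thesis
      using True by (intro exI[of _ "cell T 0"] exI[of _ 0]) auto
  next
    case False
    then have pos: "0 < L2norm g" using L2norm_nonneg[of g] by linarith
    let ?r = "\<lambda>t. (1 / L2norm g) * g t"
    have "?r \<in> L2" using gL2 by (rule L2_cmult)
    moreover have "L2norm ?r = 1" using pos by (subst L2norm_cmult) simp
    moreover have "\<forall>k<n. ip ?r (z k) = 0" using gz by (simp only: ip_cmult_left) simp
    moreover have "L2norm (\<lambda>t. g t - L2norm g * ?r t) = 0" using pos by simp
    ultimately show ?thesis
      using gT by (intro exI[of _ ?r] exI[of _ "L2norm g"]) auto
  qed
  then obtain r s where r: "r \<in> L2" "L2norm r = 1" "\<And>t. T + 1 < \<bar>t\<bar> \<Longrightarrow> r t = 0"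
    and rz: "\<And>k. k < n \<Longrightarrow> ip r (z k) = 0" and gr: "L2norm (\<lambda>t. g t - s * r t) = 0" by blast
  have "0 \<le> T + 1" "1 < C' / C" "0 < e / (\<bar>s\<bar> + 1)" using T(1) C \<open>0 < e\<close> by auto
  obtain k :: nat and y T' b where k: "k > 0" and yL2: "\<And>j. y j \<in> L2" and y0: "\<And>j t. 0 \<le> y j t"
    and ypos: "\<And>j. j < k \<Longrightarrow> 0 < L2norm (y j)" and yT: "\<And>j t. T' < \<bar>t\<bar> \<Longrightarrow> y j t = 0"
    and ybasic: "\<And>a m v. m \<le> k \<Longrightarrow> v \<in> L2 \<Longrightarrow> ip v r = 0 \<Longrightarrow> \<forall>t. T + 1 < \<bar>t\<bar> \<longrightarrow> v t = 0 \<Longrightarrow>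
      L2norm (\<lambda>t. v t + (\<Sum>j<m. a j * y j t)) \<le> C' / C * L2norm (\<lambda>t. v t + (\<Sum>j<k. a j * y j t))"
    and yr: "L2norm (\<lambda>t. r t - (\<Sum>j<k. b j * y j t)) \<le> e / (\<bar>s\<bar> + 1)"
    using nonneg_block_exists[OF r(1,2) \<open>0 \<le> T + 1\<close> r(3) \<open>1 < C' / C\<close> \<open>0 < e / (\<bar>s\<bar> + 1)\<close>] by blast
  define z' where "z' j = (if j < n then z j else y (j - n))" for j
  have lin: "(\<Sum>j<n + m. a j * z' j t) = (\<Sum>j<n. a j * z j t) + (\<Sum>j<m. a (n + j) * y j t)" for a m t
    by (simp add: sum_lessThan_append z'_def)
  have basic: "L2norm (\<lambda>t. \<Sum>j<m. a j * z' j t) \<le> C' * L2norm (\<lambda>t. \<Sum>j<n + k. a j * z' j t)" if "m \<le> n + k" for a m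
  proof -
    let ?v = "\<lambda>t. \<Sum>j<n. a j * z j t"
    have "ip ?v r = 0"
      using zL2 r(1) by (subst ip_sum_left) (auto simp: rz ip_commute[of "z _" r])
    moreover have "?v t = 0" if "T + 1 < \<bar>t\<bar>" for t using T(3) that by (intro sum.neutral) auto
    ultimately have *: "L2norm (\<lambda>t. ?v t + (\<Sum>j<i. a (n + j) * y j t)) \<le> C' / C * L2norm (\<lambda>t. \<Sum>j<n + k. a j * z' j t)"
      if "i \<le> k" for i
      unfolding lin using that vL2 by (intro ybasic) auto
    show ?thesis
    \<comment> \<open>Up to \<open>n\<close> the old constant \<open>C\<close> is combined with the
      empty partial sum of the block, giving \<open>C * (C' / C)\<close>. Beyond \<open>n\<close>
      the block estimate alone suffices, as \<open>C' / C \<le> C'\<close>.\<close>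
    proof (cases "m \<le> n")
      case True
      then have "L2norm (\<lambda>t. \<Sum>j<m. a j * z' j t) = L2norm (\<lambda>t. \<Sum>j<m. a j * z j t)"
        by (simp add: z'_def)
      also have "\<dots> \<le> C * L2norm ?v" by (rule zbasic[OF True])
      also have "\<dots> \<le> C * (C' / C * L2norm (\<lambda>t. \<Sum>j<n + k. a j * z' j t))"
        using *[of 0] C by (intro mult_left_mono) auto
      finally show ?thesis using C by simp
    next
      case False
      then obtain i where i: "m = n + i" by (metis le_Suc_ex nat_le_linear)
      have "L2norm (\<lambda>t. \<Sum>j<m. a j * z' j t) \<le> C' / C * L2norm (\<lambda>t. \<Sum>j<n + k. a j * z' j t)"
        using *[of i] that unfolding i by (simp only: lin add_le_cancel_left)
      also have "\<dots> \<le> C' * L2norm (\<lambda>t. \<Sum>j<n + k. a j * z' j t)"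
        using C by (intro mult_right_mono) (auto simp: divide_le_eq)
      finally show ?thesis .
    qed
  qed
  show thesis
  proof
    show "n < n + k" using k by simp
    show "z' j = z j" if "j < n" for j using that by (simp add: z'_def)
    have "\<forall>j<n + k. z' j \<in> L2 \<and> (\<forall>t. 0 \<le> z' j t) \<and> 0 < L2norm (z' j)"
      using zL2 z0 zpos yL2 y0 ypos by (auto simp: z'_def)
    moreover have "\<forall>j<n + k. \<forall>t. max T T' < \<bar>t\<bar> \<longrightarrow> z' j t = 0"
      using T(3) yT by (auto simp: z'_def)
    then have "\<exists>T\<ge>0. \<forall>j<n + k. \<forall>t. T < \<bar>t\<bar> \<longrightarrow> z' j t = 0"
      using T(1) by (intro exI[of _ "max T T'"]) auto
    ultimately show "positive_system C' (n + k) z'"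
      unfolding positive_system_def using basic by blast
    define a where "a j = (if j < n then c j else s * b (j - n))" for j
    have eq: "(\<lambda>t. f t - (\<Sum>j<n + k. a j * z' j t))
      = (\<lambda>t. (g t - s * r t) + s * (r t - (\<Sum>j<k. b j * y j t)))"
      unfolding lin by (simp add: a_def g_def right_diff_distrib sum_distrib_left mult.assoc fun_eq_iff)
    have "L2norm (\<lambda>t. f t - (\<Sum>j<n + k. a j * z' j t))
      \<le> L2norm (\<lambda>t. g t - s * r t) + L2norm (\<lambda>t. s * (r t - (\<Sum>j<k. b j * y j t)))"
      unfolding eq by (intro L2norm_triangle L2_diff L2_cmult L2_sum gL2 r yL2)
    also have "\<dots> = \<bar>s\<bar> * L2norm (\<lambda>t. r t - (\<Sum>j<k. b j * y j t))"
      by (simp only: gr L2norm_cmult)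
    also have "\<dots> \<le> \<bar>s\<bar> * (e / (\<bar>s\<bar> + 1))" by (intro mult_left_mono yr) simp
    also have "\<dots> \<le> e" using \<open>0 < e\<close> by (simp add: pos_divide_le_eq add_nonneg_pos algebra_simps)
    finally show "L2norm (\<lambda>t. f t - (\<Sum>j<n + k. a j * z' j t)) \<le> e" .
  qed
qed

section \<open>A Schauder basis criterion\<close>

definition finite_combinations :: "(nat \<Rightarrow> real \<Rightarrow> real) \<Rightarrow> (real \<Rightarrow> real) set" where
  "finite_combinations z = {\<lambda>t. \<Sum>j<n. a j * z j t | a n. True}"

lemma finite_combinationsI: "(\<lambda>t. \<Sum>j<n. a j * z j t) \<in> finite_combinations z"
  by (auto simp: finite_combinations_def)

lemma sum_extend_by_zero:
  fixes a :: "nat \<Rightarrow> real"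
  assumes "n \<le> N"
  shows "(\<Sum>j<N. (if j < n then a j else 0) * g j) = (\<Sum>j<n. a j * g j)"
  using assms by (intro sum.mono_neutral_cong_right) auto

lemma finite_combinations_subspace:
  assumes "\<And>j. z j \<in> L2"
  shows "L2_subspace (finite_combinations z)"
  unfolding L2_subspace_def
proof (intro conjI ballI allI)
  show "finite_combinations z \<subseteq> L2"
    using assms by (auto simp: finite_combinations_def)
  show "(\<lambda>t. 0) \<in> finite_combinations z"
    unfolding finite_combinations_def by (auto intro!: exI[of _ 0])
next
  fix f g assume "f \<in> finite_combinations z" "g \<in> finite_combinations z"
  then obtain a n b m where f: "f = (\<lambda>t. \<Sum>j<n. a j * z j t)" and g: "g = (\<lambda>t. \<Sum>j<m. b j * z j t)"
    by (auto simp: finite_combinations_def)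
  let ?N = "max n m"
  have eq: "(\<lambda>t. f t + g t) = (\<lambda>t. \<Sum>j<?N. ((if j < n then a j else 0) + (if j < m then b j else 0)) * z j t)"
    unfolding distrib_right sum.distrib by (simp add: f g sum_extend_by_zero)
  show "(\<lambda>t. f t + g t) \<in> finite_combinations z" unfolding eq by (rule finite_combinationsI)
next
  fix c f assume "f \<in> finite_combinations z"
  then obtain a n where f: "f = (\<lambda>t. \<Sum>j<n. a j * z j t)" by (auto simp: finite_combinations_def)
  have eq: "(\<lambda>t. c * f t) = (\<lambda>t. \<Sum>j<n. (c * a j) * z j t)" by (simp add: f sum_distrib_left mult.assoc)
  show "(\<lambda>t. c * f t) \<in> finite_combinations z" unfolding eq by (rule finite_combinationsI)
qed

lemma convergent_if_inverse_bound:
  fixes s :: "nat \<Rightarrow> real"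
  assumes "\<And>i l. \<bar>s i - s l\<bar> \<le> K * (1 / real (Suc i) + 1 / real (Suc l))"
  shows "convergent s"
proof (rule Cauchy_convergent, rule metric_CauchyI)
  fix e :: real assume "e > 0"
  have "(\<lambda>n. K * (1 / real (Suc n) + 1 / real (Suc n))) \<longlonglongrightarrow> K * (0 + 0)"
    by (intro tendsto_intros LIMSEQ_Suc lim_1_over_n)
  then have "eventually (\<lambda>n. K * (1 / real (Suc n) + 1 / real (Suc n)) < e) sequentially"
    using \<open>e > 0\<close> by (intro order_tendstoD(2)) auto
  then obtain M where M: "K * (1 / real (Suc M) + 1 / real (Suc M)) < e" by (auto simp: eventually_sequentially)
  \<comment> \<open>That \<open>K\<close> is non-negative follows from the assumption at
    \<open>i = l = 0\<close>.\<close>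
  have "0 \<le> K * (1 / real (Suc 0) + 1 / real (Suc 0))"
    using assms[of 0 0] by (rule order_trans[rotated]) simp
  then have "K \<ge> 0" by simp
  have "dist (s i) (s l) < e" if "i \<ge> M" "l \<ge> M" for i l
  proof -
    have "1 / real (Suc i) \<le> 1 / real (Suc M)" "1 / real (Suc l) \<le> 1 / real (Suc M)"
      using that by (auto intro!: divide_left_mono)
    then have "K * (1 / real (Suc i) + 1 / real (Suc l)) \<le> K * (1 / real (Suc M) + 1 / real (Suc M))"
      using \<open>K \<ge> 0\<close> by (intro mult_left_mono add_mono)
    then show ?thesis using assms[of i l] M unfolding dist_real_def by linarith
  qed
  then show "\<exists>M. \<forall>m\<ge>M. \<forall>n\<ge>M. dist (s m) (s n) < e" by blast
qed

lemma basis_constant_leD: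
  assumes "basis_constant_le z C" "m \<le> n"
  shows "L2norm (\<lambda>t. \<Sum>j<m. a j * z j t) \<le> C * L2norm (\<lambda>t. \<Sum>j<n. a j * z j t)"
  using assms by (simp add: basis_constant_le_def)

text \<open>The term with index \<open>k\<close> is the difference of two consecutive partial sums,
  each at most \<open>C\<close> times the full sum.\<close>

lemma basis_constant_coefficient_bound:
  assumes z: "\<And>j. z j \<in> L2" and basis: "basis_constant_le z C" and "k < n"
  shows "\<bar>a k\<bar> * L2norm (z k) \<le> 2 * C * L2norm (\<lambda>t. \<Sum>j<n. a j * z j t)"
proof -
  let ?S = "\<lambda>m t. \<Sum>j<m. a j * z j t"
  have "\<bar>a k\<bar> * L2norm (z k) = L2norm (\<lambda>t. ?S (Suc k) t - ?S k t)"
    by (simp add: L2norm_cmult)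
  also have "\<dots> \<le> L2norm (\<lambda>t. ?S (Suc k) t - 0) + L2norm (\<lambda>t. 0 - ?S k t)"
    using z by (intro L2norm_triangle_diff L2_sum L2_cmult L2_zero) auto
  also have "L2norm (\<lambda>t. 0 - ?S k t) = L2norm (\<lambda>t. ?S k t)"
    using L2norm_cmult[of "-1" "?S k"] by simp
  also have "L2norm (\<lambda>t. ?S (Suc k) t - 0) + L2norm (\<lambda>t. ?S k t) \<le> C * L2norm (?S n) + C * L2norm (?S n)"
    unfolding diff_zero using \<open>k < n\<close> by (intro add_mono basis_constant_leD[OF basis]) auto
  finally show ?thesis by simp
qed

text \<open>The coefficients of finite combinations approaching \<open>x\<close> are Cauchy by the
  coefficient bound. Their limits are the expansion, because the estimates for partial sums are
  uniform in the length and survive the limit.\<close>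

lemma schauder_basis_if_dense:
  assumes z: "\<And>j. z j \<in> L2" and zpos: "\<And>j. 0 < L2norm (z j)"
    and basis: "basis_constant_le z C"
    and dense: "\<And>f. f \<in> L2 \<Longrightarrow> f \<in> L2_closure (finite_combinations z)"
  shows "schauder_basis_L2 z"
proof -
  let ?S = "\<lambda>a n t. \<Sum>j<n. a j * z j t"
  have SL2 [simp]: "?S a n \<in> L2" for a n using z by (intro L2_sum L2_cmult)
  have C: "C \<ge> 0"
  proof -
    have "L2norm (?S (\<lambda>_. 1) 1) \<le> C * L2norm (?S (\<lambda>_. 1) 1)"
      by (rule basis_constant_leD[OF basis order_refl])
    then have "1 * L2norm (z 0) \<le> C * L2norm (z 0)" by simp
    then have "1 \<le> C" using zpos[of 0] by (rule mult_right_le_imp_le)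
    then show ?thesis by simp
  qed
  have Sdiff: "?S (\<lambda>j. a j - b j) n t = ?S a n t - ?S b n t" for a b n t
    by (simp add: left_diff_distrib sum_subtractf)
  have "\<exists>!a. (\<lambda>n. L2norm (\<lambda>t. x t - ?S a n t)) \<longlonglongrightarrow> 0" if x: "x \<in> L2" for x
  proof (rule ex_ex1I)
    have "\<exists>w\<in>finite_combinations z. L2norm (\<lambda>t. x t - w t) < 1 / real (Suc i)" for i
      using dense[OF x] by (simp add: L2_closure_def)
    then have "\<exists>a n. L2norm (\<lambda>t. x t - ?S a n t) < 1 / real (Suc i)" for i
      unfolding finite_combinations_def by blast
    then obtain a n where an: "\<And>i. L2norm (\<lambda>t. x t - ?S (a i) (n i) t) < 1 / real (Suc i)" by metis
    define A where "A i j = (if j < n i then a i j else 0)" for i j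
    have A: "?S (A i) N t = ?S (a i) (n i) t" if "n i \<le> N" for i N t
      unfolding A_def using that by (rule sum_extend_by_zero)
    have close: "L2norm (\<lambda>t. x t - ?S (A i) N t) \<le> 1 / real (Suc i)" if "n i \<le> N" for i N
      unfolding A[OF that] using an[of i] by simp
    have pair: "L2norm (?S (\<lambda>j. A i j - A l j) N) \<le> 1 / real (Suc i) + 1 / real (Suc l)"
      if "n i \<le> N" "n l \<le> N" for i l N
    proof -
      have "L2norm (\<lambda>t. ?S (A i) N t - ?S (A l) N t)
        \<le> L2norm (\<lambda>t. ?S (A i) N t - x t) + L2norm (\<lambda>t. x t - ?S (A l) N t)"
        using x by (intro L2norm_triangle_diff) simp_all
      then show ?thesis
        unfolding Sdiff using close[OF that(1)] close[OF that(2)]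
        by (simp only: L2norm_minus_commute[of _ x])
    qed
    \<comment> \<open>For short \<open>N\<close> the combinations may be incomplete. Passing to a
      length that contains both costs the factor \<open>C\<close>, and the bound no longer depends
      on \<open>N\<close>.\<close>
    have pairN: "L2norm (?S (\<lambda>j. A i j - A l j) N) \<le> C * (1 / real (Suc i) + 1 / real (Suc l))" for i l N
    proof -
      let ?M = "max N (max (n i) (n l))"
      have "L2norm (?S (\<lambda>j. A i j - A l j) N) \<le> C * L2norm (?S (\<lambda>j. A i j - A l j) ?M)"
        by (rule basis_constant_leD[OF basis max.cobounded1])
      also have "\<dots> \<le> C * (1 / real (Suc i) + 1 / real (Suc l))"
        using C by (intro mult_left_mono pair) auto
      finally show ?thesis .
    qed
    have "convergent (\<lambda>i. A i k)" for k
    proof (rule convergent_if_inverse_bound)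
      fix i l
      have "\<bar>A i k - A l k\<bar> * L2norm (z k) \<le> 2 * C * (C * (1 / real (Suc i) + 1 / real (Suc l)))"
        using basis_constant_coefficient_bound[OF z basis, of k "Suc k" "\<lambda>j. A i j - A l j"]
          mult_left_mono[OF pairN[of i l "Suc k"], of "2 * C"] C by linarith
      then show "\<bar>A i k - A l k\<bar> \<le> (2 * C * C / L2norm (z k)) * (1 / real (Suc i) + 1 / real (Suc l))"
        using zpos[of k] by (simp only: times_divide_eq_left pos_le_divide_eq mult.assoc)
    qed
    then obtain \<alpha> where \<alpha>: "\<And>k. (\<lambda>i. A i k) \<longlonglongrightarrow> \<alpha> k" unfolding convergent_def by metis
    \<comment> \<open>Let \<open>l\<close> tend to infinity in \<open>pairN\<close> with
      \<open>N\<close> fixed: only finitely many coefficients are involved, so the discrepancy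
      \<open>?d l\<close> vanishes.\<close>
    have tail: "L2norm (?S (\<lambda>j. A i j - \<alpha> j) N) \<le> C * (1 / real (Suc i))" for i N
    proof -
      let ?d = "\<lambda>l. \<Sum>j<N. \<bar>A l j - \<alpha> j\<bar> * L2norm (z j)"
      have small: "L2norm (?S (\<lambda>j. A l j - \<alpha> j) m) \<le> (\<Sum>j<m. \<bar>A l j - \<alpha> j\<bar> * L2norm (z j))" for l m
      proof (induction m)
        case (Suc m)
        have "L2norm (\<lambda>t. ?S (\<lambda>j. A l j - \<alpha> j) m t + (A l m - \<alpha> m) * z m t)
          \<le> L2norm (?S (\<lambda>j. A l j - \<alpha> j) m) + L2norm (\<lambda>t. (A l m - \<alpha> m) * z m t)"
          using z by (intro L2norm_triangle L2_cmult) auto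
        then show ?case using Suc by (simp add: L2norm_cmult)
      qed simp
      have "L2norm (?S (\<lambda>j. A i j - \<alpha> j) N) \<le> C * (1 / real (Suc i) + 1 / real (Suc l)) + ?d l" for l
      proof -
        have "?S (\<lambda>j. A i j - \<alpha> j) N = (\<lambda>t. ?S (\<lambda>j. A i j - A l j) N t + ?S (\<lambda>j. A l j - \<alpha> j) N t)"
          unfolding Sdiff by simp
        then have "L2norm (?S (\<lambda>j. A i j - \<alpha> j) N)
            \<le> L2norm (?S (\<lambda>j. A i j - A l j) N) + L2norm (?S (\<lambda>j. A l j - \<alpha> j) N)"
          using L2norm_triangle[OF SL2 SL2] by simp
        then show ?thesis using pairN[of i l N] small[of l N] by linarith
      qed
      moreover have "(\<lambda>l. C * (1 / real (Suc i) + 1 / real (Suc l)) + ?d l)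
        \<longlonglongrightarrow> C * (1 / real (Suc i) + 0) + (\<Sum>j<N. \<bar>\<alpha> j - \<alpha> j\<bar> * L2norm (z j))"
        by (intro tendsto_intros \<alpha> LIMSEQ_Suc lim_1_over_n)
      ultimately show ?thesis
        using LIMSEQ_le_const[of _ "C * (1 / real (Suc i) + 0) + (\<Sum>j<N. \<bar>\<alpha> j - \<alpha> j\<bar> * L2norm (z j))"] by auto
    qed
    have "(\<lambda>N. L2norm (\<lambda>t. x t - ?S \<alpha> N t)) \<longlonglongrightarrow> 0"
    proof (rule LIMSEQ_I)
      fix e :: real assume "e > 0"
      have "(\<lambda>i. 1 / real (Suc i) + C * (1 / real (Suc i))) \<longlonglongrightarrow> 0 + C * 0"
        by (intro tendsto_intros LIMSEQ_Suc lim_1_over_n)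
      then have "eventually (\<lambda>i. 1 / real (Suc i) + C * (1 / real (Suc i)) < e) sequentially"
        using \<open>e > 0\<close> by (intro order_tendstoD(2)) auto
      then obtain i where i: "1 / real (Suc i) + C * (1 / real (Suc i)) < e" by (auto simp: eventually_sequentially)
      have "L2norm (\<lambda>t. x t - ?S \<alpha> N t) < e" if "n i \<le> N" for N
      proof -
        have "L2norm (\<lambda>t. x t - ?S \<alpha> N t)
          \<le> L2norm (\<lambda>t. x t - ?S (A i) N t) + L2norm (\<lambda>t. ?S (A i) N t - ?S \<alpha> N t)"
          using x by (intro L2norm_triangle_diff) simp_all
        then show ?thesis using close[OF that] tail[of i N] i unfolding Sdiff by linarith
      qed
      then show "\<exists>M. \<forall>N\<ge>M. norm (L2norm (\<lambda>t. x t - ?S \<alpha> N t) - 0) < e" by auto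
    qed
    then show "\<exists>a. (\<lambda>n. L2norm (\<lambda>t. x t - ?S a n t)) \<longlonglongrightarrow> 0" by blast
  next
    fix a b
    assume a: "(\<lambda>n. L2norm (\<lambda>t. x t - ?S a n t)) \<longlonglongrightarrow> 0"
      and b: "(\<lambda>n. L2norm (\<lambda>t. x t - ?S b n t)) \<longlonglongrightarrow> 0"
    have le: "L2norm (?S (\<lambda>j. a j - b j) n) \<le> L2norm (\<lambda>t. x t - ?S a n t) + L2norm (\<lambda>t. x t - ?S b n t)" for n
    proof -
      have "L2norm (\<lambda>t. ?S a n t - ?S b n t) \<le> L2norm (\<lambda>t. ?S a n t - x t) + L2norm (\<lambda>t. x t - ?S b n t)"
        using x by (intro L2norm_triangle_diff) simp_all
      then show ?thesis unfolding Sdiff by (simp only: L2norm_minus_commute[of _ x])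
    qed
    \<comment> \<open>The partial sums of the difference of the two expansions tend to 0, and they
      bound each of its coefficients.\<close>
    have "a k - b k = 0" for k
    proof -
      have "(\<lambda>n. 2 * C * (L2norm (\<lambda>t. x t - ?S a n t) + L2norm (\<lambda>t. x t - ?S b n t))) \<longlonglongrightarrow> 2 * C * (0 + 0)"
        by (intro tendsto_intros a b)
      moreover have "\<forall>n\<ge>Suc k. \<bar>a k - b k\<bar> * L2norm (z k)
          \<le> 2 * C * (L2norm (\<lambda>t. x t - ?S a n t) + L2norm (\<lambda>t. x t - ?S b n t))"
      proof (intro allI impI)
        fix m assume "Suc k \<le> m"
        then have "\<bar>a k - b k\<bar> * L2norm (z k) \<le> 2 * C * L2norm (?S (\<lambda>j. a j - b j) m)"
          by (intro basis_constant_coefficient_bound[OF z basis]) simp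
        also have "\<dots> \<le> 2 * C * (L2norm (\<lambda>t. x t - ?S a m t) + L2norm (\<lambda>t. x t - ?S b m t))"
          using C by (intro mult_left_mono le) simp
        finally show "\<bar>a k - b k\<bar> * L2norm (z k)
          \<le> 2 * C * (L2norm (\<lambda>t. x t - ?S a m t) + L2norm (\<lambda>t. x t - ?S b m t))" .
      qed
      ultimately have "\<bar>a k - b k\<bar> * L2norm (z k) \<le> 2 * C * (0 + 0)"
        by (intro LIMSEQ_le_const) blast+
      then show ?thesis using zpos[of k] by (simp add: mult_le_0_iff)
    qed
    then show "a = b" by auto
  qed
  then show ?thesis using z by (simp add: schauder_basis_L2_def)
qed

section \<open>The basis\<close>

theorem theorem2p2:
  fixes \<epsilon> :: real
  assumes "\<epsilon> > 0"
  shows "\<exists>z::nat \<Rightarrow> real \<Rightarrow> real. schauder_basis_L2 z \<and>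
           (\<forall>j. AE t in lborel. z j t \<ge> 0) \<and> basis_constant_le z (1 + \<epsilon>)"
proof -
  define I where "I = from_nat_into (\<rat> \<times> \<rat> :: (real \<times> real) set)"
  \<comment> \<open>Decoding \<open>k\<close> as a pair lets every rational interval recur
    infinitely often, so it is approximated with arbitrarily small errors
    \<open>1 / (k + 1)\<close>.\<close>
  define F where "F k = indicat_real (case I (fst (prod_decode k)) of (p, q) \<Rightarrow> {p..q})" for k
  \<comment> \<open>Strictly increasing from \<open>C 0 = 1\<close> and below
    \<open>1 + \<epsilon>\<close>, so each extension step has a factor
    \<open>C (Suc k) / C k > 1\<close> at its disposal.\<close>
  define C where "C k = 1 + \<epsilon> - \<epsilon> / real (Suc k)" for k
  have C: "1 \<le> C k" "C k < C (Suc k)" "C k \<le> 1 + \<epsilon>" for k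
    using assms by (auto simp: C_def divide_le_eq intro!: divide_strict_left_mono)
  have F: "F k \<in> L2" "\<exists>S. \<forall>t. S < \<bar>t\<bar> \<longrightarrow> F k t = 0" for k
  proof -
    obtain p q where pq: "I (fst (prod_decode k)) = (p, q)" by fastforce
    then show "F k \<in> L2" by (simp add: F_def)
    show "\<exists>S. \<forall>t. S < \<bar>t\<bar> \<longrightarrow> F k t = 0"
      unfolding F_def pq by (intro exI[of _ "max \<bar>p\<bar> \<bar>q\<bar>"]) (auto simp: indicator_def)
  qed
  have "\<exists>s. \<forall>k. positive_system (C k) (fst (s k)) (snd (s k)) \<and>
    (fst (s k) < fst (s (Suc k)) \<and> (\<forall>j<fst (s k). snd (s (Suc k)) j = snd (s k) j) \<and>
     (\<exists>a. L2norm (\<lambda>t. F k t - (\<Sum>j<fst (s (Suc k)). a j * snd (s (Suc k)) j t)) \<le> 1 / real (Suc k)))"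
  proof (rule dependent_nat_choice)
    show "\<exists>s. positive_system (C 0) (fst s) (snd s)"
      by (rule exI[of _ "(0, \<lambda>_ _. 0)"]) (simp add: positive_system_0)
  next
    fix s k assume s: "positive_system (C k) (fst s) (snd s)"
    obtain S where S: "\<And>t. S < \<bar>t\<bar> \<Longrightarrow> F k t = 0" using F(2) by blast
    have "0 < 1 / real (Suc k)" by simp
    from positive_system_extend[OF s C(1,2) F(1) S this]
    obtain n' z' a where "fst s < n'" "\<And>j. j < fst s \<Longrightarrow> z' j = snd s j" "positive_system (C (Suc k)) n' z'"
      "L2norm (\<lambda>t. F k t - (\<Sum>j<n'. a j * z' j t)) \<le> 1 / real (Suc k)"
      by blast
    then show "\<exists>s'. positive_system (C (Suc k)) (fst s') (snd s') \<and>
      (fst s < fst s' \<and> (\<forall>j<fst s. snd s' j = snd s j) \<and>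
       (\<exists>a. L2norm (\<lambda>t. F k t - (\<Sum>j<fst s'. a j * snd s' j t)) \<le> 1 / real (Suc k)))"
      by (intro exI[of _ "(n', z')"]) auto
  qed
  then obtain s where s: "\<And>k. positive_system (C k) (fst (s k)) (snd (s k))"
    and s_less: "\<And>k. fst (s k) < fst (s (Suc k))"
    and s_eq: "\<And>k j. j < fst (s k) \<Longrightarrow> snd (s (Suc k)) j = snd (s k) j"
    and s_approx: "\<And>k. \<exists>a. L2norm (\<lambda>t. F k t - (\<Sum>j<fst (s (Suc k)). a j * snd (s (Suc k)) j t)) \<le> 1 / real (Suc k)"
    by blast
  define N where "N k = fst (s k)" for k
  have mono: "strict_mono N" unfolding N_def using s_less by (rule strict_monoI_Suc)
  have N_ge: "k \<le> N k" for k using mono by (rule strict_mono_imp_increasing)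
  have stable: "snd (s (k + i)) j = snd (s k) j" if "j < N k" for k i j
  proof (induction i)
    case (Suc i)
    have "N k \<le> N (k + i)" using mono by (simp add: strict_mono_less_eq)
    then show ?case using Suc s_eq[of j "k + i"] that by (simp add: N_def)
  qed simp
  \<comment> \<open>Stage \<open>Suc j\<close> has at least \<open>Suc j\<close> functions, so entry
    \<open>j\<close> is already present there, and later stages keep it.\<close>
  define z where "z j = snd (s (Suc j)) j" for j
  have z_eq: "z j = snd (s k) j" if "j < N k" for j k
  proof (cases "k \<le> Suc j")
    case True
    then show ?thesis using stable[OF that, of "Suc j - k"] by (simp add: z_def)
  next
    case False
    have "j < N (Suc j)" using N_ge[of "Suc j"] by simp
    then show ?thesis using stable[of j "Suc j" "k - Suc j"] False by (simp add: z_def)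
  qed
  have sys: "positive_system (C k) (N k) z" for k
    using positive_system_cong[OF s[of k]] z_eq[of _ k] by (simp add: N_def)
  have zj: "z j \<in> L2" "0 \<le> z j t" "0 < L2norm (z j)" for j t
    using sys[of "Suc j"] N_ge[of "Suc j"] unfolding positive_system_def by auto
  have basis: "basis_constant_le z (1 + \<epsilon>)"
    unfolding basis_constant_le_def
  proof (intro allI impI)
    fix a :: "nat \<Rightarrow> real" and m n :: nat assume "m \<le> n"
    \<comment> \<open>Stage \<open>n\<close> compares with the sum of length
      \<open>N n \<ge> n\<close>. Coefficients cut off at \<open>n\<close> turn that sum into the
      one of length \<open>n\<close>.\<close>
    define b where "b j = (if j < n then a j else 0)" for j
    have b: "(\<Sum>j<k. b j * z j t) = (\<Sum>j<min k n. a j * z j t)" for k t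
      by (rule sum.mono_neutral_cong_right) (auto simp: b_def)
    have "L2norm (\<lambda>t. \<Sum>j<m. b j * z j t) \<le> C n * L2norm (\<lambda>t. \<Sum>j<N n. b j * z j t)"
      using sys[of n] N_ge[of n] \<open>m \<le> n\<close> unfolding positive_system_def by auto
    then have "L2norm (\<lambda>t. \<Sum>j<m. a j * z j t) \<le> C n * L2norm (\<lambda>t. \<Sum>j<n. a j * z j t)"
      using N_ge[of n] \<open>m \<le> n\<close> by (simp add: b min_absorb1 min_absorb2)
    also have "\<dots> \<le> (1 + \<epsilon>) * L2norm (\<lambda>t. \<Sum>j<n. a j * z j t)"
      using C(3) by (intro mult_right_mono) auto
    finally show "L2norm (\<lambda>t. \<Sum>j<m. a j * z j t) \<le> (1 + \<epsilon>) * L2norm (\<lambda>t. \<Sum>j<n. a j * z j t)" .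
  qed
  have rat: "indicator {p..q} \<in> L2_closure (finite_combinations z)" if "p \<in> \<rat>" "q \<in> \<rat>" for p q :: real
    unfolding L2_closure_def
  proof (intro CollectI conjI allI impI L2_indicator_Icc)
    fix e :: real assume "e > 0"
    have "countable (\<rat> \<times> \<rat> :: (real \<times> real) set)" by (intro countable_SIGMA countable_rat)
    from from_nat_into_surj[OF this, of "(p, q)"] that obtain i where i: "I i = (p, q)"
      by (auto simp: I_def)
    obtain l where l: "1 / real (Suc l) < e" using nat_approx_posE[OF \<open>e > 0\<close>] by blast
    \<comment> \<open>At this stage the interval with index \<open>i\<close> is approximated, and
      \<open>l \<le> k\<close> makes the error smaller than \<open>e\<close>.\<close>
    define k where "k = prod_encode (i, l)"
    have "l \<le> k" unfolding k_def by (rule le_prod_encode_2)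
    then have "1 / real (Suc k) \<le> 1 / real (Suc l)" by (intro divide_left_mono) auto
    moreover have "F k = indicator {p..q}" by (simp add: F_def k_def i)
    moreover obtain a where "L2norm (\<lambda>t. F k t - (\<Sum>j<N (Suc k). a j * snd (s (Suc k)) j t)) \<le> 1 / real (Suc k)"
      using s_approx[of k] by (auto simp: N_def)
    moreover have "(\<Sum>j<N (Suc k). a j * snd (s (Suc k)) j t) = (\<Sum>j<N (Suc k). a j * z j t)" for t
      by (rule sum.cong) (auto simp: z_eq[of _ "Suc k"])
    ultimately have "L2norm (\<lambda>t. indicator {p..q} t - (\<Sum>j<N (Suc k). a j * z j t)) < e"
      using l by simp
    then show "\<exists>w\<in>finite_combinations z. L2norm (\<lambda>t. indicator {p..q} t - w t) < e"
      by (intro bexI[OF _ finite_combinationsI])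
  qed
  have "schauder_basis_L2 z"
    by (rule schauder_basis_if_dense[OF zj(1,3) basis])
      (rule L2_closure_eq_L2[OF finite_combinations_subspace[OF zj(1)] rat])
  then show ?thesis using zj(2) basis by auto
qed

end
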